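(* Let $\beta>1$ be a real algebraic number of degree $3$. Then $\gamma(\beta)>0$ if and only if $\beta$ is a Pisot unit satisfying property (F).
   Context: For a real number $\beta>1$, the $\beta$-transformation is $T_\beta: x\mapsto \beta x-\lfloor\beta x\rfloor$. The $\beta$-expansion of $\xi\in[0,1)$ is the sequence $d_\beta(\xi)=(a_n)_{n\ge1}$ with $a_n=\lfloor\beta T_\beta^{n-1}(\xi)\rfloor\in\{0,1,\ldots,\lceil\beta\rceil-1\}$, so that $\xi=\sum_{n\ge1}a_n\beta^{-n}$. A sequence $(a_n)_{n\ge1}$ is purely periodic if there is a positive integer $p$ with $a_{n+p}=a_n$ for every $n\ge1$. Define $$\gamma(\beta):=\sup\{c\in[0,1)\mid \text{for every rational number } p/q \text{ with } 0\le p/q\le c,\ d_\beta(p/q)\text{ is purely periodic}\}.$$ A Pisot number is a real algebraic integer greater than $1$ whose Galois conjugates different from itself all have modulus less than $1$. A Pisot unit is a Pisot number that is a unit of the ring of integers of the number field it generates. Property (F) for $\beta$: every $x\in\mathbb{Z}[1/\beta]\cap[0,1)$ has a finite $\beta$-expansion, i.e. $d_\beta(x)$ has only finitely many nonzero terms. *)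

theory Defs
  imports Complex_Main "HOL-Computational_Algebra.Computational_Algebra"
begin

section \<open>Beta-expansions\<close>

definition beta_transformation :: "real \<Rightarrow> real \<Rightarrow> real" where
  "beta_transformation \<beta> x = \<beta> * x - of_int \<lfloor>\<beta> * x\<rfloor>"

text \<open>
  Expansions are indexed from 1 as in \<open>\<xi> = (\<Sum>n\<ge>1. a\<^sub>n \<beta>\<^sup>-\<^sup>n)\<close>; the value at index 0 is junk and is
  excluded wherever an expansion is used.
\<close>

definition beta_expansion :: "real \<Rightarrow> real \<Rightarrow> nat \<Rightarrow> int" where
  "beta_expansion \<beta> \<xi> n = \<lfloor>\<beta> * (beta_transformation \<beta> ^^ (n - 1)) \<xi>\<rfloor>"

definition purely_periodic :: "(nat \<Rightarrow> 'a) \<Rightarrow> bool" where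
  "purely_periodic a \<longleftrightarrow> (\<exists>p>0. \<forall>n\<ge>1. a (n + p) = a n)"

text \<open>The supremum is over a set that contains 0 and is bounded by 1.\<close>

definition gamma :: "real \<Rightarrow> real" where
  "gamma \<beta> = Sup {c \<in> {0..<1}. \<forall>x\<in>\<rat>. 0 \<le> x \<and> x \<le> c \<longrightarrow> purely_periodic (beta_expansion \<beta> x)}"

definition Z_inverse :: "real \<Rightarrow> real set" where
  "Z_inverse \<beta> = {poly (map_poly of_int p) (1 / \<beta>) | p :: int poly. True}"

definition property_F :: "real \<Rightarrow> bool" where
  "property_F \<beta> \<longleftrightarrow>
     (\<forall>x \<in> Z_inverse \<beta> \<inter> {0..<1}. finite {n. n \<ge> 1 \<and> beta_expansion \<beta> x n \<noteq> 0})"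


section \<open>Pisot units\<close>

text \<open>Junk unless \<open>x\<close> is algebraic; for algebraic \<open>x\<close> see \<open>min_poly_unique\<close> below.\<close>

definition min_poly :: "'a :: field_char_0 \<Rightarrow> rat poly" where
  "min_poly x = (THE p. lead_coeff p = 1 \<and> irreducible p \<and> poly (map_poly of_rat p) x = 0)"

definition algebraic_degree :: "'a :: field_char_0 \<Rightarrow> nat" where
  "algebraic_degree x = degree (min_poly x)"

definition galois_conjugates :: "real \<Rightarrow> complex set" where
  "galois_conjugates x = {z. poly (map_poly of_rat (min_poly x)) z = 0}"

definition pisot_number :: "real \<Rightarrow> bool" where
  "pisot_number \<beta> \<longleftrightarrow> algebraic_int \<beta> \<and> \<beta> > 1 \<and>
     (\<forall>z \<in> galois_conjugates \<beta>. z \<noteq> of_real \<beta> \<longrightarrow> norm z < 1)"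

text \<open>
  The smallest subfield of the reals containing \<open>\<beta>\<close>. Closure under subtraction and division,
  together with \<open>1 \<in> K\<close>, gives all field operations; the case \<open>x / 0 = 0\<close> is harmless.
\<close>

definition generated_field :: "real \<Rightarrow> real set" where
  "generated_field \<beta> =
     \<Inter> {K. 1 \<in> K \<and> \<beta> \<in> K \<and> (\<forall>x\<in>K. \<forall>y\<in>K. x - y \<in> K \<and> x / y \<in> K)}"

definition ring_of_integers :: "real set \<Rightarrow> real set" where
  "ring_of_integers K = {x \<in> K. algebraic_int x}"

definition pisot_unit :: "real \<Rightarrow> bool" where
  "pisot_unit \<beta> \<longleftrightarrow> pisot_number \<beta> \<and>
     (\<exists>y \<in> ring_of_integers (generated_field \<beta>). \<beta> * y = 1)"


section \<open>Well-definedness of the minimal polynomial\<close>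

lemma poly_of_rat_add:
  "poly (map_poly of_rat (p + q)) (x :: 'a :: field_char_0) =
     poly (map_poly of_rat p) x + poly (map_poly of_rat q) x"
proof -
  have "map_poly of_rat (p + q) = map_poly of_rat p + (map_poly of_rat q :: 'a poly)"
    by (intro poly_eqI) (simp add: coeff_map_poly of_rat_add)
  then show ?thesis by simp
qed

lemma poly_of_rat_smult:
  "poly (map_poly of_rat (smult c p)) (x :: 'a :: field_char_0) =
     of_rat c * poly (map_poly of_rat p) x"
proof -
  have "map_poly of_rat (smult c p) = smult (of_rat c) (map_poly of_rat p :: 'a poly)"
    by (intro poly_eqI) (simp add: coeff_map_poly of_rat_mult)
  then show ?thesis by simp
qed

lemma poly_of_rat_mult:
  "poly (map_poly of_rat (p * q)) (x :: 'a :: field_char_0) =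
     poly (map_poly of_rat p) x * poly (map_poly of_rat q) x"
proof (induction p)
  case (pCons a p)
  have "poly (map_poly of_rat (pCons 0 (p * q))) x = x * poly (map_poly of_rat (p * q)) x"
    by (simp add: map_poly_pCons)
  with pCons show ?case
    by (simp add: map_poly_pCons poly_of_rat_add poly_of_rat_smult algebra_simps)
qed simp

lemma min_poly_ex1:
  assumes "algebraic (x :: 'a :: field_char_0)"
  shows "\<exists>!p. lead_coeff p = 1 \<and> irreducible p \<and> poly (map_poly of_rat p) x = 0"
proof -
  define e where "e p = poly (map_poly of_rat p) x" for p :: "rat poly"
  have e_mult: "e (p * q) = e p * e q" for p q
    by (simp add: e_def poly_of_rat_mult)
  have e_add: "e (p + q) = e p + e q" for p q
    by (simp add: e_def poly_of_rat_add)
  obtain p0 :: "int poly" where p0: "p0 \<noteq> 0" "poly (map_poly of_int p0) x = 0"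
    using assms by (rule algebraicE')
  have "map_poly of_rat (map_poly of_int p0 :: rat poly) = (map_poly of_int p0 :: 'a poly)"
    by (intro poly_eqI) (simp add: coeff_map_poly)
  moreover have "(map_poly of_int p0 :: rat poly) \<noteq> 0"
    using p0(1) by (auto simp: poly_eq_iff coeff_map_poly)
  ultimately have "\<exists>q. q \<noteq> 0 \<and> e q = 0"
    using p0(2) by (auto simp: e_def)
  then obtain m where m: "m \<noteq> 0" "e m = 0"
    and m_min: "\<And>q. q \<noteq> 0 \<Longrightarrow> e q = 0 \<Longrightarrow> degree m \<le> degree q"
    using ex_has_least_nat[of "\<lambda>q. q \<noteq> 0 \<and> e q = 0" _ degree] by metis
  define p where "p = smult (1 / lead_coeff m) m"
  have p: "p \<noteq> 0" "e p = 0" "lead_coeff p = 1" "degree p = degree m"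
    using m by (auto simp: p_def e_def poly_of_rat_smult)
  have min: "degree p \<le> degree q" if "q \<noteq> 0" "e q = 0" for q
    using m_min that p(4) by simp
  have nonunit: "\<not> is_unit p"
  proof
    assume "is_unit p"
    then have "p = [:1:]"
      using p(3) by (metis is_unit_iff_degree p(1) degree_0_id lead_coeff_pCons(2) degree_eq_zeroE coeff_pCons_0 degree_pCons_0)
    then show False using p(2) by (simp add: e_def map_poly_pCons)
  qed
  have irr: "irreducible p"
  proof (rule irreducibleI)
    fix a b assume ab: "p = a * b"
    then have nz: "a \<noteq> 0" "b \<noteq> 0" using p(1) by auto
    have deg: "degree p = degree a + degree b"
      using ab nz by (simp add: degree_mult_eq)
    have "e a = 0 \<or> e b = 0" using ab p(2) by (simp add: e_mult)
    then show "is_unit a \<or> is_unit b"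
      using min[OF nz(1)] min[OF nz(2)] deg nz by (auto simp: is_unit_iff_degree)
  qed (use p nonunit in auto)
  have "q = p" if q: "lead_coeff q = 1" "irreducible q" "e q = 0" for q
  proof -
    have "e q = e (q div p) * e p + e (q mod p)"
      using e_add[of "q div p * p" "q mod p"] by (simp add: e_mult)
    then have "e (q mod p) = 0" using p(2) q(3) by simp
    then have "q mod p = 0"
      using min[of "q mod p"] degree_mod_less[OF p(1), of q] by force
    then obtain c where c: "q = p * c" by (auto simp: mod_eq_0_iff_dvd dvd_def)
    then have "is_unit c" using q(2) nonunit by (auto dest: irreducibleD)
    then obtain k where k: "c = [:k:]"
      by (metis is_unit_poly_iff)
    have "lead_coeff q = lead_coeff p * lead_coeff c" by (simp add: c lead_coeff_mult)
    then have "k = 1" using p(3) q(1) k by simp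
    then show ?thesis using c k by simp
  qed
  with p irr show ?thesis unfolding e_def by (intro ex1I[of _ p]) blast+
qed

lemma min_poly_unique:
  assumes "algebraic (x :: 'a :: field_char_0)"
  shows "lead_coeff (min_poly x) = 1" "irreducible (min_poly x)"
    and "poly (map_poly of_rat (min_poly x)) x = 0"
    and "\<And>p. lead_coeff p = 1 \<Longrightarrow> irreducible p \<Longrightarrow> poly (map_poly of_rat p) x = 0 \<Longrightarrow> p = min_poly x"
  using theI'[OF min_poly_ex1[OF assms]] min_poly_ex1[OF assms]
  unfolding min_poly_def by blast+

end

theory Submission
  imports Defs "HOL-Analysis.Analysis"
begin

text \<open>
  If all small rationals have purely periodic expansions, then periodicity of \<open>1/n\<close> gives
  \<open>\<beta>\<^sup>p = 1 + n d\<close> with \<open>d \<in> \<int>[\<beta>]\<close>, so \<open>\<beta>\<close> is an algebraic integer and, for suitable \<open>n\<close>, a unit;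
  Schmidt's argument excludes conjugates outside the closed unit disc, and degree 3 excludes the unit
  circle. A positive conjugate \<open>t < 1\<close> is impossible, because a rational \<open>r > 0\<close> with period \<open>p\<close> would
  give \<open>(t\<^sup>p - 1) r\<close> as a sum of nonnegative terms. What remains are the polynomials
  \<open>X\<^sup>3 - a X\<^sup>2 - b X - 1\<close>. For \<open>-1 \<le> b \<le> a + 1\<close> property (F) follows from Brunotte's algorithm for
  the associated shift radix system. For \<open>b \<le> -2\<close> the conjugates \<open>\<alpha>\<close>, \<open>cnj \<alpha>\<close> are not real, as real ones
  would be positive, and every
  positive element of \<open>\<int>[\<beta>]\<close> with conjugate close to \<open>-1/\<alpha>\<close> has infinite expansion. Multiplication by
  powers of \<open>\<alpha>\<close> that are nearly positive reals moves this open set to arbitrarily small negative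
  rationals \<open>-r\<close>; but if \<open>r\<close> were purely periodic, then \<open>(\<beta>\<^sup>n - 1) r\<close> would have finite expansion for
  infinitely many \<open>n\<close>, while its conjugate tends to \<open>-r\<close>.

  Conversely, let \<open>x\<close> be a small rational with denominator \<open>q\<close>, and \<open>\<beta>\<^sup>n \<equiv> 1\<close> modulo \<open>q\<close>. Then
  \<open>m = (\<beta>\<^sup>n - 1) x\<close> lies in \<open>\<int>[\<beta>]\<close> and has small conjugates, so by (F) its expansion has no fractional
  part. Hence \<open>\<beta>\<^sup>n x = m + x\<close> has fractional part \<open>x\<close>, that is, \<open>n\<close> is a period of \<open>x\<close>.
\<close>

section \<open>The beta-transformation\<close>

locale beta_map =
  fixes \<beta> :: real
  assumes gt1: "\<beta> > 1"
begin

abbreviation T :: "real \<Rightarrow> real" where "T \<equiv> beta_transformation \<beta>"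

abbreviation digit :: "real \<Rightarrow> nat \<Rightarrow> int" where "digit x n \<equiv> \<lfloor>\<beta> * (T ^^ n) x\<rfloor>"

lemma T_eq: "T x = \<beta> * x - of_int \<lfloor>\<beta> * x\<rfloor>"
  by (simp add: beta_transformation_def)

lemma T_frac: "T x = frac (\<beta> * x)"
  by (simp add: T_eq frac_def)

lemma T_0 [simp]: "T 0 = 0"
  by (simp add: T_eq)

lemma T_funpow_0 [simp]: "(T ^^ n) 0 = 0"
  by (induction n) auto

lemma T_range: "0 \<le> T x" "T x < 1"
  by (simp_all add: T_frac frac_lt_1)

lemma T_funpow_range:
  assumes "0 \<le> x" "x < 1"
  shows "0 \<le> (T ^^ n) x" "(T ^^ n) x < 1"
  using assms T_range by (induction n) auto

lemma T_unique:
  assumes "\<beta> * x = of_int k + y" "0 \<le> y" "y < 1"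
  shows "T x = y"
proof -
  have "\<lfloor>\<beta> * x\<rfloor> = k" using assms by (intro floor_unique) auto
  then show ?thesis using assms by (simp add: T_eq)
qed

lemma T_div: "0 \<le> x \<Longrightarrow> x < 1 \<Longrightarrow> T (x / \<beta>) = x"
  using gt1 by (intro T_unique[of _ 0]) auto

lemma T_funpow_div:
  assumes "0 \<le> x" "x < 1"
  shows "(T ^^ n) (x / \<beta> ^ n) = x"
proof (induction n)
  case (Suc n)
  have "1 \<le> \<beta> ^ n" using gt1 by (simp add: one_le_power less_imp_le)
  with assms have "0 \<le> x / \<beta> ^ n" "x / \<beta> ^ n < 1"
    by (auto simp: divide_simps)
  then have "T (x / \<beta> ^ n / \<beta>) = x / \<beta> ^ n"
    by (rule T_div)
  then have "(T ^^ n) (T (x / \<beta> ^ Suc n)) = x"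
    using Suc by (simp add: mult.commute)
  then show ?case by (simp only: funpow_Suc_right o_apply)
qed auto

lemma T_funpow_fixed: "T x = x \<Longrightarrow> (T ^^ n) x = x"
  by (induction n) auto

lemma T_funpow_add: "(T ^^ (m + n)) x = (T ^^ m) ((T ^^ n) x)"
  by (simp add: funpow_add)

lemma T_funpow_stays_0: "(T ^^ m) x = 0 \<Longrightarrow> m \<le> n \<Longrightarrow> (T ^^ n) x = 0"
  using T_funpow_add[of "n - m" m x] by simp

lemma T_funpow_mult_period: "(T ^^ p) x = x \<Longrightarrow> (T ^^ (p * k)) x = x"
  by (induction k) (auto simp: funpow_add)

text \<open>Horner form of the first \<open>n\<close> digits of \<open>x\<close>. The digits always
  belong to the base \<open>\<beta>\<close> while \<open>z\<close> is free: at
  \<open>z = \<beta>\<close> this is the integer part of \<open>\<beta> ^ n * x\<close>, at a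
  conjugate of \<open>\<beta>\<close> the image of that integer part.\<close>

primrec digit_sum :: "'a :: ring_1 \<Rightarrow> real \<Rightarrow> nat \<Rightarrow> 'a" where
  "digit_sum z x 0 = 0"
| "digit_sum z x (Suc n) = z * digit_sum z x n + of_int (digit x n)"

lemma power_eq_digit_sum: "\<beta> ^ n * x = digit_sum \<beta> x n + (T ^^ n) x"
proof (induction n)
  case (Suc n)
  have "\<beta> ^ Suc n * x = \<beta> * (digit_sum \<beta> x n + (T ^^ n) x)"
    using Suc by (simp add: mult.assoc)
  also have "\<dots> = digit_sum \<beta> x (Suc n) + (T ^^ Suc n) x"
    by (simp add: T_eq algebra_simps)
  finally show ?case .
qed simp

lemma digit_sum_add:
  "digit_sum z x (m + n) = z ^ m * digit_sum z x n + digit_sum z ((T ^^ n) x) m"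
  by (induction m) (auto simp: algebra_simps funpow_add)

lemma digit_range:
  assumes "0 \<le> x" "x < 1"
  shows "0 \<le> digit x n" "of_int (digit x n) \<le> \<beta>"
proof -
  have "0 \<le> (T ^^ n) x" "(T ^^ n) x < 1" using T_funpow_range assms by auto
  with gt1 show "0 \<le> digit x n" by simp
  have "of_int (digit x n) \<le> \<beta> * (T ^^ n) x" by simp
  also have "\<dots> \<le> \<beta>" using gt1 \<open>(T ^^ n) x < 1\<close> by (simp add: mult_left_le)
  finally show "of_int (digit x n) \<le> \<beta>" .
qed

text \<open>Digits are at most \<open>\<beta>\<close>, so this is a geometric series; the bound is
  the fixed point of \<open>s = norm z * s + \<beta>\<close>.\<close>

lemma norm_digit_sum_le:
  fixes z :: "'a :: real_normed_field"
  assumes "0 \<le> x" "x < 1" "norm z < 1"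
  shows "norm (digit_sum z x n) \<le> \<beta> / (1 - norm z)"
proof (induction n)
  case 0
  then show ?case using gt1 assms by simp
next
  case (Suc n)
  have "norm (digit_sum z x (Suc n)) \<le> norm z * norm (digit_sum z x n) + \<beta>"
    using digit_range[OF assms(1,2), of n]
    by (auto intro!: order_trans[OF norm_triangle_ineq] simp: norm_mult)
  also have "\<dots> \<le> norm z * (\<beta> / (1 - norm z)) + \<beta>"
    using Suc by (intro add_right_mono mult_left_mono) auto
  also have "\<dots> = \<beta> / (1 - norm z)"
    using assms by (simp add: field_simps)
  finally show ?case .
qed

lemma norm_digit_sum_le_expanding:
  fixes z :: "'a :: real_normed_field"
  assumes "0 \<le> x" "x < 1" "norm z > 1"
  shows "norm (digit_sum z x n) \<le> \<beta> / (norm z - 1) * norm z ^ n"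
proof -
  \<comment> \<open>With the extra \<open>- 1\<close> the recursion for the bound is an exact
    equality and the induction closes.\<close>
  have "norm (digit_sum z x n) \<le> \<beta> / (norm z - 1) * (norm z ^ n - 1)"
  proof (induction n)
    case (Suc n)
    have "norm (digit_sum z x (Suc n)) \<le> norm z * norm (digit_sum z x n) + \<beta>"
      using digit_range[OF assms(1,2), of n]
      by (auto intro!: order_trans[OF norm_triangle_ineq] simp: norm_mult)
    also have "\<dots> \<le> norm z * (\<beta> / (norm z - 1) * (norm z ^ n - 1)) + \<beta>"
      using Suc by (intro add_right_mono mult_left_mono) auto
    also have "\<dots> = \<beta> / (norm z - 1) * (norm z ^ Suc n - 1)"
      using assms by (simp add: field_simps)
    finally show ?case .
  qed simp
  also have "\<dots> \<le> \<beta> / (norm z - 1) * norm z ^ n"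
    using gt1 assms by (intro mult_left_mono) auto
  finally show ?thesis .
qed

lemma digit_sum_nonneg:
  fixes t :: "'a :: linordered_idom"
  assumes "0 \<le> x" "x < 1" "0 \<le> t"
  shows "0 \<le> digit_sum t x n"
  using digit_range[OF assms(1,2)] assms(3) by (induction n) auto

lemma digit_sum_of_real:
  "digit_sum (of_real t :: 'a :: real_normed_field) x n = of_real (digit_sum t x n)"
  by (induction n) auto

text \<open>\<open>degree P < Suc n\<close> together with \<open>coeff P n = 0\<close> expresses
  that the degree is below \<open>n\<close>, in a form that still covers \<open>n = 0\<close>, where
  \<open>P\<close> is zero and has degree 0.\<close>

lemma digit_sum_poly:
  "\<exists>P :: int poly. degree P < Suc n \<and> coeff P n = 0 \<and>
     (\<forall>z :: 'a :: comm_ring_1. digit_sum z x n = poly (map_poly of_int P) z)"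
proof (induction n)
  case 0
  show ?case by (rule exI[of _ 0]) auto
next
  case (Suc n)
  then obtain P :: "int poly" where P: "degree P < Suc n" "coeff P n = 0"
    "\<And>z :: 'a. digit_sum z x n = poly (map_poly of_int P) z" by blast
  have "degree (pCons (digit x n) P) < Suc (Suc n)"
    using P(1) degree_pCons_le[of "digit x n" P] by linarith
  moreover have "digit_sum z x (Suc n) = poly (map_poly of_int (pCons (digit x n) P)) z" for z :: 'a
    by (simp add: P(3) map_poly_pCons)
  moreover have "coeff (pCons (digit x n) P) (Suc n) = 0" using P(2) by simp
  ultimately show ?case by blast
qed

text \<open>No borrow reaches the first \<open>n\<close> digits, since the amount taken away does
  not exceed the tail left after them; the induction peels off the last of these digits.\<close>

lemma T_funpow_sub:
  assumes "0 \<le> t" "t \<le> (T ^^ n) x" "0 \<le> x" "x < 1" "0 \<le> y" "y = x - t / \<beta> ^ n"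
  shows "(T ^^ n) y = (T ^^ n) x - t"
  using assms
proof (induction n arbitrary: t y)
  case (Suc n)
  have "t / \<beta> \<le> (T ^^ n) x"
  proof -
    have "t \<le> \<beta> * (T ^^ n) x - of_int \<lfloor>\<beta> * (T ^^ n) x\<rfloor>"
      using Suc.prems(2) by (simp add: T_eq[of "(T ^^ n) x"])
    moreover have "0 \<le> digit x n" using digit_range Suc.prems by auto
    ultimately have "t \<le> \<beta> * (T ^^ n) x" by linarith
    then show ?thesis using gt1 by (simp add: divide_simps mult.commute)
  qed
  then have IH: "(T ^^ n) y = (T ^^ n) x - t / \<beta>"
    using Suc.prems gt1 by (intro Suc.IH) auto
  have "T ((T ^^ n) x - t / \<beta>) = T ((T ^^ n) x) - t"
    using gt1 Suc.prems T_range[of "(T ^^ n) x"]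
    by (intro T_unique[of _ "digit x n"]) (auto simp: T_eq[of "(T ^^ n) x"] algebra_simps)
  then show ?case using IH by simp
qed auto

text \<open>The second hypothesis excludes a carry at every position, so the first \<open>n\<close>
  digits are unchanged.\<close>

lemma T_funpow_add_small:
  assumes "0 \<le> t" "\<And>i. i \<le> n \<Longrightarrow> (T ^^ i) x + t / \<beta> ^ (n - i) < 1"
    and "y = x + t / \<beta> ^ n" "0 \<le> x"
  shows "(T ^^ n) y = (T ^^ n) x + t"
proof -
  have "i \<le> n \<Longrightarrow> (T ^^ i) y = (T ^^ i) x + t / \<beta> ^ (n - i)" for i
  proof (induction i)
    case (Suc i)
    then have IH: "(T ^^ i) y = (T ^^ i) x + t / \<beta> ^ (n - i)" by simp
    have e: "n - i = Suc (n - Suc i)" using Suc.prems by simp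
    have b: "\<beta> * (t / \<beta> ^ (n - i)) = t / \<beta> ^ (n - Suc i)"
      unfolding e using gt1 by simp
    have p: "0 \<le> t / \<beta> ^ (n - Suc i)" using assms(1) gt1 by simp
    have "T ((T ^^ i) x + t / \<beta> ^ (n - i)) = T ((T ^^ i) x) + t / \<beta> ^ (n - Suc i)"
      using assms(2)[OF Suc.prems] T_range(1)[of "(T ^^ i) x"] b p
      by (intro T_unique[of _ "digit x i"]) (auto simp: T_eq[of "(T ^^ i) x"] distrib_left)
    then show ?case using IH by simp
  qed (use assms in auto)
  from this[of n] show ?thesis by simp
qed

lemma eventually_below_power: "\<exists>N0. \<forall>N\<ge>N0. x < \<beta> ^ N"
proof -
  obtain N0 where "x < \<beta> ^ N0" using gt1 real_arch_pow by blast
  then have "x < \<beta> ^ N" if "N \<ge> N0" for N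
    using power_increasing[OF that, of \<beta>] gt1 by linarith
  then show ?thesis by blast
qed

section \<open>Periodic and finite expansions\<close>

lemma eq_0_if_power_mult_le_1:
  assumes "\<And>n :: nat. \<beta> ^ n * \<bar>d\<bar> \<le> 1"
  shows "d = 0"
proof (rule ccontr)
  assume "d \<noteq> 0"
  obtain N where "1 / \<bar>d\<bar> < \<beta> ^ N" using eventually_below_power by blast
  with \<open>d \<noteq> 0\<close> have "1 < \<beta> ^ N * \<bar>d\<bar>" by (simp add: divide_simps)
  with assms[of N] show False by simp
qed

text \<open>Points of [0,1) with equal digits differ by at most \<open>1 / \<beta> ^ n\<close> for
  every \<open>n\<close> and so coincide; hence a period of the digits is a period of the
  orbit.\<close>

lemma purely_periodic_iff:
  assumes "0 \<le> x" "x < 1"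
  shows "purely_periodic (beta_expansion \<beta> x) \<longleftrightarrow> (\<exists>p>0. (T ^^ p) x = x)"
proof
  assume "purely_periodic (beta_expansion \<beta> x)"
  then obtain p where p: "p > 0" "\<And>n. n \<ge> 1 \<Longrightarrow> beta_expansion \<beta> x (n + p) = beta_expansion \<beta> x n"
    by (auto simp: purely_periodic_def)
  have d: "digit ((T ^^ p) x) n = digit x n" for n
    using p(2)[of "Suc n"] by (simp add: beta_expansion_def funpow_add)
  have ds: "digit_sum \<beta> ((T ^^ p) x) n = digit_sum \<beta> x n" for n
    by (induction n) (auto simp: d)
  have r: "0 \<le> (T ^^ p) x" "(T ^^ p) x < 1" using assms T_funpow_range by auto
  have "\<beta> ^ n * \<bar>(T ^^ p) x - x\<bar> \<le> 1" for n
  proof -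
    have "\<beta> ^ n * ((T ^^ p) x - x) = (T ^^ n) ((T ^^ p) x) - (T ^^ n) x"
      by (simp add: right_diff_distrib power_eq_digit_sum ds)
    moreover have "\<bar>(T ^^ n) ((T ^^ p) x) - (T ^^ n) x\<bar> \<le> 1"
      using T_funpow_range[OF assms, of n] T_funpow_range[OF r, of n] by linarith
    ultimately have "\<bar>\<beta> ^ n * ((T ^^ p) x - x)\<bar> \<le> 1" by simp
    then show ?thesis using gt1 by (simp add: abs_mult)
  qed
  then have "(T ^^ p) x - x = 0" by (rule eq_0_if_power_mult_le_1)
  then show "\<exists>p>0. (T ^^ p) x = x" using p by auto
next
  assume "\<exists>p>0. (T ^^ p) x = x"
  then obtain p where p: "p > 0" "(T ^^ p) x = x" by blast
  have "beta_expansion \<beta> x (n + p) = beta_expansion \<beta> x n" if "n \<ge> 1" for n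
  proof -
    have "n + p - 1 = (n - 1) + p" using that by simp
    then show ?thesis unfolding beta_expansion_def by (simp only: T_funpow_add p(2))
  qed
  with p(1) show "purely_periodic (beta_expansion \<beta> x)" by (auto simp: purely_periodic_def)
qed

text \<open>A tail all of whose digits vanish stays at most 1 under multiplication by every power of
  \<open>\<beta>\<close>, so it is 0.\<close>

lemma finite_expansion_iff:
  assumes "0 \<le> x" "x < 1"
  shows "finite {n. n \<ge> 1 \<and> beta_expansion \<beta> x n \<noteq> 0} \<longleftrightarrow> (\<exists>k. (T ^^ k) x = 0)"
proof
  assume "finite {n. n \<ge> 1 \<and> beta_expansion \<beta> x n \<noteq> 0}"
  then obtain k where k: "\<And>n. n \<ge> 1 \<Longrightarrow> beta_expansion \<beta> x n \<noteq> 0 \<Longrightarrow> n \<le> k"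
    by (auto simp: finite_nat_set_iff_bounded_le)
  have d: "digit ((T ^^ k) x) n = 0" for n
    using k[of "Suc (n + k)"] by (auto simp: beta_expansion_def funpow_add)
  have ds: "digit_sum \<beta> ((T ^^ k) x) n = 0" for n
    by (induction n) (auto simp: d)
  have r: "0 \<le> (T ^^ k) x" "(T ^^ k) x < 1" using assms T_funpow_range by auto
  have "(T ^^ k) x = 0"
  proof (rule eq_0_if_power_mult_le_1)
    fix n
    have "\<beta> ^ n * (T ^^ k) x = (T ^^ n) ((T ^^ k) x)" by (simp add: power_eq_digit_sum ds)
    also have "\<dots> \<le> 1" using T_funpow_range[OF r, of n] by simp
    finally show "\<beta> ^ n * \<bar>(T ^^ k) x\<bar> \<le> 1" using r by simp
  qed
  then show "\<exists>k. (T ^^ k) x = 0" ..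
next
  assume "\<exists>k. (T ^^ k) x = 0"
  then obtain k where k: "(T ^^ k) x = 0" ..
  have "n \<le> k" if "n \<ge> 1" "beta_expansion \<beta> x n \<noteq> 0" for n
    using T_funpow_stays_0[OF k, of "n - 1"] that by (force simp: beta_expansion_def)
  then have "{n. n \<ge> 1 \<and> beta_expansion \<beta> x n \<noteq> 0} \<subseteq> {..k}" by auto
  then show "finite {n. n \<ge> 1 \<and> beta_expansion \<beta> x n \<noteq> 0}"
    by (rule finite_subset) simp
qed

lemma gamma_pos_iff:
  "gamma \<beta> > 0 \<longleftrightarrow> (\<exists>c>0. c < 1 \<and> (\<forall>x\<in>\<rat>. 0 \<le> x \<and> x \<le> c \<longrightarrow> (\<exists>p>0. (T ^^ p) x = x)))"
proof -
  define S where "S = {c \<in> {0..<1}. \<forall>x\<in>\<rat>. 0 \<le> x \<and> x \<le> c \<longrightarrow> purely_periodic (beta_expansion \<beta> x)}"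
  have S: "c \<in> S \<longleftrightarrow> 0 \<le> c \<and> c < 1 \<and> (\<forall>x\<in>\<rat>. 0 \<le> x \<and> x \<le> c \<longrightarrow> (\<exists>p>0. (T ^^ p) x = x))" for c
    unfolding S_def by (auto simp: purely_periodic_iff)
  have "0 \<in> S" by (auto simp: S)
  then have "S \<noteq> {}" by auto
  moreover have "bdd_above S" by (rule bdd_aboveI[of _ 1]) (auto simp: S)
  ultimately have "0 < Sup S \<longleftrightarrow> (\<exists>c\<in>S. 0 < c)" by (rule less_cSup_iff)
  moreover have "gamma \<beta> = Sup S" by (simp add: gamma_def S_def)
  ultimately show ?thesis by (auto simp: S)
qed

end

section \<open>Cubic integers and their conjugates\<close>

lemma Rats_nonneg_cases:
  assumes "x \<in> \<rat>" "0 \<le> (x :: real)"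
  obtains p q :: nat where "q > 0" "x = p / q"
proof -
  from assms(1) obtain s t :: int where st: "t > 0" "x = s / t"
    by (cases rule: Rats_cases') auto
  with assms(2) have "s \<ge> 0" by (auto simp: zero_le_divide_iff)
  with st that[of "nat t" "nat s"] show ?thesis by auto
qed

text \<open>\<open>sum_conj\<close> and \<open>prod_conj\<close> make \<open>\<alpha>1\<close> and
  \<open>\<alpha>2\<close> the roots of \<open>X^3 - a X^2 - b X - c\<close> divided by
  \<open>X - \<beta>\<close>; \<open>indep\<close> says that \<open>\<beta>\<close> has degree
  3.\<close>

locale cubic = beta_map \<beta> for \<beta> :: real +
  fixes a b c :: int and \<alpha>1 \<alpha>2 :: complex
  assumes cubic_eq: "\<beta> ^ 3 = a * \<beta>\<^sup>2 + b * \<beta> + c"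
    and sum_conj: "\<alpha>1 + \<alpha>2 = of_real (a - \<beta>)"
    and prod_conj: "\<alpha>1 * \<alpha>2 = of_real (\<beta>\<^sup>2 - a * \<beta> - b)"
    and indep: "\<And>u v w. of_int u + of_int v * \<beta> + of_int w * \<beta>\<^sup>2 = 0 \<Longrightarrow> u = 0 \<and> v = 0 \<and> w = 0"
begin

lemma c_eq: "of_int c = \<beta> * (\<beta>\<^sup>2 - a * \<beta> - b)"
  using cubic_eq by (simp add: algebra_simps power2_eq_square power3_eq_cube)

lemma conj_quadratic:
  assumes "\<alpha> \<in> {\<alpha>1, \<alpha>2}"
  shows "\<alpha>\<^sup>2 = of_real (a - \<beta>) * \<alpha> - of_real (\<beta>\<^sup>2 - a * \<beta> - b)"
  unfolding sum_conj[symmetric] prod_conj[symmetric]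
  using assms by (auto simp: algebra_simps power2_eq_square)

lemma conj_cubic:
  assumes "\<alpha> \<in> {\<alpha>1, \<alpha>2}"
  shows "\<alpha> ^ 3 = of_int a * \<alpha>\<^sup>2 + of_int b * \<alpha> + of_int c"
proof -
  define B where "B = complex_of_real \<beta>"
  have c: "(of_int c :: complex) = B * (B\<^sup>2 - of_int a * B - of_int b)"
    using arg_cong[OF c_eq, of complex_of_real] by (simp add: B_def)
  have "\<alpha>\<^sup>2 = (of_int a - B) * \<alpha> - (B\<^sup>2 - of_int a * B - of_int b)"
    using conj_quadratic[OF assms] by (simp add: B_def)
  then have e: "\<alpha> * \<alpha> = (of_int a - B) * \<alpha> - (B * B - of_int a * B - of_int b)" by (simp add: power2_eq_square)
  have "\<alpha> ^ 3 - (of_int a * \<alpha>\<^sup>2 + of_int b * \<alpha> + of_int c) =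
      (\<alpha> - B) * (\<alpha> * \<alpha> - ((of_int a - B) * \<alpha> - (B * B - of_int a * B - of_int b)))"
    unfolding c by (simp add: algebra_simps power2_eq_square power3_eq_cube)
  then show ?thesis unfolding e by simp
qed

text \<open>An element of \<open>\<int>[\<beta>]\<close> together with its images under the two other embeddings.\<close>

definition Zel :: "real \<Rightarrow> complex \<Rightarrow> complex \<Rightarrow> bool" where
  "Zel x y z \<longleftrightarrow> (\<exists>u v w :: int.
     x = of_int u + of_int v * \<beta> + of_int w * \<beta>\<^sup>2 \<and>
     y = of_int u + of_int v * \<alpha>1 + of_int w * \<alpha>1\<^sup>2 \<and>
     z = of_int u + of_int v * \<alpha>2 + of_int w * \<alpha>2\<^sup>2)"

lemma ZelI:
  fixes u v w :: int
  assumes "x = of_int u + of_int v * \<beta> + of_int w * \<beta>\<^sup>2"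
    "y = of_int u + of_int v * \<alpha>1 + of_int w * \<alpha>1\<^sup>2"
    "z = of_int u + of_int v * \<alpha>2 + of_int w * \<alpha>2\<^sup>2"
  shows "Zel x y z"
  using assms unfolding Zel_def by blast

text \<open>By \<open>indep\<close> the coordinates are unique, so the embeddings are well defined
  and an equation between real elements carries over to the conjugates.\<close>

lemma Zel_unique:
  assumes "Zel x y z" "Zel x y' z'"
  shows "y' = y" "z' = z"
proof -
  obtain u v w u' v' w' :: int where
    x: "x = of_int u + of_int v * \<beta> + of_int w * \<beta>\<^sup>2" "x = of_int u' + of_int v' * \<beta> + of_int w' * \<beta>\<^sup>2"
    and y: "y = of_int u + of_int v * \<alpha>1 + of_int w * \<alpha>1\<^sup>2" "y' = of_int u' + of_int v' * \<alpha>1 + of_int w' * \<alpha>1\<^sup>2"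
    and z: "z = of_int u + of_int v * \<alpha>2 + of_int w * \<alpha>2\<^sup>2" "z' = of_int u' + of_int v' * \<alpha>2 + of_int w' * \<alpha>2\<^sup>2"
    using assms unfolding Zel_def by blast
  have "of_int (u - u') + of_int (v - v') * \<beta> + of_int (w - w') * \<beta>\<^sup>2 = 0"
    using x by (simp add: algebra_simps)
  from indep[OF this] show "y' = y" "z' = z" using y z by auto
qed

section \<open>Arithmetic in the ring generated by \<open>\<beta>\<close>\<close>

lemma Zel_of_int: "Zel (of_int k) (of_int k) (of_int k)"
  by (rule ZelI[of _ k 0 0]) auto

lemma Zel_0: "Zel 0 0 0" using Zel_of_int[of 0] by simp
lemma Zel_1: "Zel 1 1 1" using Zel_of_int[of 1] by simp

lemma Zel_add:
  assumes "Zel x y z" "Zel x' y' z'"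
  shows "Zel (x + x') (y + y') (z + z')"
proof -
  from assms(1) obtain u v w :: int where 1:
    "x = of_int u + of_int v * \<beta> + of_int w * \<beta>\<^sup>2"
    "y = of_int u + of_int v * \<alpha>1 + of_int w * \<alpha>1\<^sup>2"
    "z = of_int u + of_int v * \<alpha>2 + of_int w * \<alpha>2\<^sup>2" unfolding Zel_def by blast
  from assms(2) obtain u' v' w' :: int where 2:
    "x' = of_int u' + of_int v' * \<beta> + of_int w' * \<beta>\<^sup>2"
    "y' = of_int u' + of_int v' * \<alpha>1 + of_int w' * \<alpha>1\<^sup>2"
    "z' = of_int u' + of_int v' * \<alpha>2 + of_int w' * \<alpha>2\<^sup>2" unfolding Zel_def by blast
  show ?thesis
    by (rule ZelI[of _ "u + u'" "v + v'" "w + w'"]) (auto simp: 1 2 algebra_simps)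
qed

lemma Zel_mult_int:
  assumes "Zel x y z"
  shows "Zel (of_int k * x) (of_int k * y) (of_int k * z)"
proof -
  from assms obtain u v w :: int where 1:
    "x = of_int u + of_int v * \<beta> + of_int w * \<beta>\<^sup>2"
    "y = of_int u + of_int v * \<alpha>1 + of_int w * \<alpha>1\<^sup>2"
    "z = of_int u + of_int v * \<alpha>2 + of_int w * \<alpha>2\<^sup>2" unfolding Zel_def by blast
  show ?thesis
    by (rule ZelI[of _ "k * u" "k * v" "k * w"]) (auto simp: 1 algebra_simps)
qed

lemma Zel_uminus: "Zel x y z \<Longrightarrow> Zel (- x) (- y) (- z)"
  using Zel_mult_int[of x y z "-1"] by simp

lemma Zel_diff:
  assumes "Zel x y z" "Zel x' y' z'"
  shows "Zel (x - x') (y - y') (z - z')"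
  using Zel_add[OF assms(1) Zel_uminus[OF assms(2)]] by simp

lemma Zel_mult_beta:
  assumes "Zel x y z"
  shows "Zel (\<beta> * x) (\<alpha>1 * y) (\<alpha>2 * z)"
proof -
  from assms obtain u v w :: int where 1:
    "x = of_int u + of_int v * \<beta> + of_int w * \<beta>\<^sup>2"
    "y = of_int u + of_int v * \<alpha>1 + of_int w * \<alpha>1\<^sup>2"
    "z = of_int u + of_int v * \<alpha>2 + of_int w * \<alpha>2\<^sup>2" unfolding Zel_def by blast
  \<comment> \<open>The reduction of \<open>t ^ 3\<close> is stated for an arbitrary commutative
    ring, so that it serves \<open>\<beta>\<close> and both conjugates.\<close>
  have *: "t * (of_int u + of_int v * t + of_int w * t\<^sup>2) =
      of_int (w * c) + of_int (u + w * b) * t + of_int (v + w * a) * t\<^sup>2"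
    if "t ^ 3 = of_int a * t\<^sup>2 + of_int b * t + of_int c" for t :: "'t :: comm_ring_1"
  proof -
    have "t * (of_int u + of_int v * t + of_int w * t\<^sup>2) = of_int u * t + of_int v * t\<^sup>2 + of_int w * t ^ 3"
      by (simp add: algebra_simps power2_eq_square power3_eq_cube)
    then show ?thesis unfolding that by (simp add: algebra_simps)
  qed
  show ?thesis
    using cubic_eq conj_cubic[of \<alpha>1] conj_cubic[of \<alpha>2]
    by (intro ZelI[of _ "w * c" "u + w * b" "v + w * a"]; unfold 1; intro *) auto
qed

lemma Zel_mult_power: "Zel x y z \<Longrightarrow> Zel (\<beta> ^ n * x) (\<alpha>1 ^ n * y) (\<alpha>2 ^ n * z)"
proof (induction n)
  case (Suc n)
  then show ?case using Zel_mult_beta[of "\<beta> ^ n * x" "\<alpha>1 ^ n * y" "\<alpha>2 ^ n * z"] by (simp add: mult.assoc)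
qed simp

lemma Zel_power: "Zel (\<beta> ^ n) (\<alpha>1 ^ n) (\<alpha>2 ^ n)"
  using Zel_mult_power[OF Zel_1, of n] by simp

lemma Zel_digit_sum: "Zel (digit_sum \<beta> x n) (digit_sum \<alpha>1 x n) (digit_sum \<alpha>2 x n)"
  by (induction n) (auto intro!: Zel_0 Zel_add Zel_mult_beta Zel_of_int)

text \<open>Extends the embeddings to rational multiples: the equation is cleared of its denominator
  and compared by \<open>Zel_unique\<close>.\<close>

lemma Zel_mult_rat:
  fixes p q :: nat and x x' :: real
  assumes "Zel x y z" "Zel x' y' z'" "q > 0" "q * x = p * x'"
  shows "y = of_nat p / of_nat q * y'" "z = of_nat p / of_nat q * z'"
proof -
  have "Zel (q * x) (of_nat q * y) (of_nat q * z)" "Zel (q * x) (of_nat p * y') (of_nat p * z')"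
    using Zel_mult_int[OF assms(1), of "int q"] Zel_mult_int[OF assms(2), of "int p"] assms(4) by simp_all
  from Zel_unique[OF this] assms(3) show "y = of_nat p / of_nat q * y'" "z = of_nat p / of_nat q * z'"
    by (simp_all add: field_simps)
qed

text \<open>Conjugates of the identity \<open>digit_sum \<beta> r n = (\<beta> ^ n - 1) * r\<close>;
  the rational number \<open>r\<close> is fixed by the embeddings.\<close>

lemma digit_sum_periodic:
  assumes "r \<in> \<rat>" "0 \<le> r" "(T ^^ n) r = r"
  shows "digit_sum \<alpha>1 r n = of_real r * (\<alpha>1 ^ n - 1)" "digit_sum \<alpha>2 r n = of_real r * (\<alpha>2 ^ n - 1)"
proof -
  obtain p q :: nat where r: "q > 0" "r = p / q" using Rats_nonneg_cases[OF assms(1,2)] by blast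
  have Zn: "Zel (\<beta> ^ n - 1) (\<alpha>1 ^ n - 1) (\<alpha>2 ^ n - 1)" by (intro Zel_diff Zel_power Zel_1)
  have "digit_sum \<beta> r n = (\<beta> ^ n - 1) * r"
    using power_eq_digit_sum[of n r] assms(3) by (simp add: algebra_simps)
  then have "q * digit_sum \<beta> r n = p * (\<beta> ^ n - 1)" using r by simp
  from Zel_mult_rat[OF Zel_digit_sum Zn r(1) this]
  show "digit_sum \<alpha>1 r n = of_real r * (\<alpha>1 ^ n - 1)" "digit_sum \<alpha>2 r n = of_real r * (\<alpha>2 ^ n - 1)"
    by (simp_all add: r)
qed

text \<open>Results are proved for \<open>\<alpha>1\<close> and transferred to
  \<open>\<alpha>2\<close> by this symmetry.\<close>

lemma swap_conj: "cubic \<beta> a b c \<alpha>2 \<alpha>1"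
proof
  show "\<alpha>2 + \<alpha>1 = of_real (a - \<beta>)" using sum_conj by (simp only: add.commute)
  show "\<alpha>2 * \<alpha>1 = of_real (\<beta>\<^sup>2 - a * \<beta> - b)" using prod_conj by (simp only: mult.commute)
qed (fact cubic_eq indep)+

text \<open>Otherwise the derivative of the cubic would vanish at \<open>\<beta>\<close>, a
  quadratic relation with leading coefficient 3.\<close>

lemma conj_ne_beta: "\<alpha>1 \<noteq> of_real \<beta>"
proof
  assume "\<alpha>1 = of_real \<beta>"
  with conj_quadratic[of \<alpha>1]
  have "complex_of_real (\<beta>\<^sup>2) = of_real ((a - \<beta>) * \<beta> - (\<beta>\<^sup>2 - a * \<beta> - b))" by simp
  then have "\<beta>\<^sup>2 = (a - \<beta>) * \<beta> - (\<beta>\<^sup>2 - a * \<beta> - b)" by (simp only: of_real_eq_iff)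
  then have "of_int (- b) + of_int (- 2 * a) * \<beta> + of_int 3 * \<beta>\<^sup>2 = 0"
    by (simp add: algebra_simps power2_eq_square)
  from indep[OF this] show False by simp
qed

text \<open>Otherwise the discriminant of the quadratic cofactor would vanish, which is again a
  quadratic relation for \<open>\<beta>\<close>.\<close>

lemma conj_distinct: "\<alpha>1 \<noteq> \<alpha>2"
proof
  assume e: "\<alpha>1 = \<alpha>2"
  have "(\<alpha>1 + \<alpha>2)\<^sup>2 = 4 * (\<alpha>1 * \<alpha>2)" unfolding e by (simp add: power2_eq_square)
  then have "complex_of_real ((a - \<beta>)\<^sup>2) = of_real (4 * (\<beta>\<^sup>2 - a * \<beta> - b))"
    unfolding sum_conj prod_conj by simp
  then have "(a - \<beta>)\<^sup>2 = 4 * (\<beta>\<^sup>2 - a * \<beta> - b)" by (simp only: of_real_eq_iff)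
  then have "of_int (- a * a - 4 * b) + of_int (- 2 * a) * \<beta> + of_int 3 * \<beta>\<^sup>2 = 0"
    by (simp add: algebra_simps power2_eq_square)
  from indep[OF this] show False by simp
qed

lemma conj_cases: "\<alpha>1 \<in> \<real> \<and> \<alpha>2 \<in> \<real> \<or> \<alpha>2 = cnj \<alpha>1"
proof -
  have im: "Im \<alpha>1 + Im \<alpha>2 = 0" using arg_cong[OF sum_conj, of Im] by simp
  have "Re \<alpha>1 * Im \<alpha>2 + Im \<alpha>1 * Re \<alpha>2 = 0" using arg_cong[OF prod_conj, of Im] by simp
  moreover have "Im \<alpha>2 = - Im \<alpha>1" using im by linarith
  ultimately have "Im \<alpha>1 * (Re \<alpha>2 - Re \<alpha>1) = 0"
    by (simp add: algebra_simps)
  then have "Im \<alpha>1 = 0 \<or> Re \<alpha>1 = Re \<alpha>2" by auto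
  then show ?thesis using im by (auto simp: complex_is_Real_iff complex_eq_iff)
qed

lemma Zel_cnj:
  assumes "\<alpha>2 = cnj \<alpha>1" "Zel x y z"
  shows "z = cnj y"
  using assms unfolding Zel_def by auto

text \<open>Inverts the Vandermonde system by divided differences: those between
  \<open>\<beta>\<close> and each conjugate give \<open>v + w * (\<beta> + \<alpha>)\<close>, and
  the difference of these two isolates \<open>w\<close>; then \<open>v\<close> and \<open>u\<close>
  follow.\<close>

lemma coord_bound:
  "\<exists>M. \<forall>u v w :: int.
     \<bar>of_int u + of_int v * \<beta> + of_int w * \<beta>\<^sup>2\<bar> \<le> B \<longrightarrow>
     norm (of_int u + of_int v * \<alpha>1 + of_int w * \<alpha>1\<^sup>2) \<le> B \<longrightarrow>
     norm (of_int u + of_int v * \<alpha>2 + of_int w * \<alpha>2\<^sup>2) \<le> B \<longrightarrow>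
     \<bar>u\<bar> \<le> M \<and> \<bar>v\<bar> \<le> M \<and> \<bar>w\<bar> \<le> M"
proof -
  define D1 where "D1 = 2 * B / norm (of_real \<beta> - \<alpha>1)"
  define D2 where "D2 = 2 * B / norm (of_real \<beta> - \<alpha>2)"
  define W where "W = (D1 + D2) / norm (\<alpha>1 - \<alpha>2)"
  define V where "V = D1 + W * norm (of_real \<beta> + \<alpha>1)"
  define U where "U = B + V * \<beta> + W * \<beta>\<^sup>2"
  have ne: "of_real \<beta> - \<alpha>1 \<noteq> 0" "of_real \<beta> - \<alpha>2 \<noteq> 0" "\<alpha>1 - \<alpha>2 \<noteq> 0"
    using conj_ne_beta cubic.conj_ne_beta[OF swap_conj] conj_distinct by auto
  have main: "\<bar>real_of_int u\<bar> \<le> U \<and> \<bar>real_of_int v\<bar> \<le> V \<and> \<bar>real_of_int w\<bar> \<le> W"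
    if x: "\<bar>of_int u + of_int v * \<beta> + of_int w * \<beta>\<^sup>2\<bar> \<le> B"
      and y: "norm (of_int u + of_int v * \<alpha>1 + of_int w * \<alpha>1\<^sup>2) \<le> B"
      and z: "norm (of_int u + of_int v * \<alpha>2 + of_int w * \<alpha>2\<^sup>2) \<le> B" for u v w :: int
  proof -
    define X where "X = complex_of_real (of_int u + of_int v * \<beta> + of_int w * \<beta>\<^sup>2)"
    have nX: "norm X \<le> B" unfolding X_def norm_of_real by (rule x)
    have d: "norm (of_int v + of_int w * (of_real \<beta> + \<alpha>)) \<le> 2 * B / norm (of_real \<beta> - \<alpha>)"
      if "norm (of_int u + of_int v * \<alpha> + of_int w * \<alpha>\<^sup>2) \<le> B" "of_real \<beta> - \<alpha> \<noteq> 0" for \<alpha> :: complex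
    proof -
      have "X - (of_int u + of_int v * \<alpha> + of_int w * \<alpha>\<^sup>2) =
          (of_int v + of_int w * (of_real \<beta> + \<alpha>)) * (of_real \<beta> - \<alpha>)"
        by (simp add: X_def algebra_simps power2_eq_square)
      moreover have "norm (X - (of_int u + of_int v * \<alpha> + of_int w * \<alpha>\<^sup>2)) \<le> 2 * B"
        using norm_triangle_ineq4[of X "of_int u + of_int v * \<alpha> + of_int w * \<alpha>\<^sup>2"] nX that(1) by linarith
      ultimately show ?thesis using that(2)
        by (simp add: norm_mult le_divide_eq)
    qed
    have d1: "norm (of_int v + of_int w * (of_real \<beta> + \<alpha>1)) \<le> D1"
      unfolding D1_def using d[OF y ne(1)] .
    have d2: "norm (of_int v + of_int w * (of_real \<beta> + \<alpha>2)) \<le> D2"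
      unfolding D2_def using d[OF z ne(2)] .
    have "of_int w * (\<alpha>1 - \<alpha>2) = (of_int v + of_int w * (of_real \<beta> + \<alpha>1)) - (of_int v + of_int w * (of_real \<beta> + \<alpha>2))"
      by (simp add: algebra_simps)
    also have "norm \<dots> \<le> D1 + D2"
      using norm_triangle_ineq4 d1 d2 by (meson add_mono order_trans)
    finally have w: "\<bar>real_of_int w\<bar> \<le> W"
      unfolding W_def using ne(3) by (simp add: norm_mult le_divide_eq)
    have "(of_int v :: complex) = (of_int v + of_int w * (of_real \<beta> + \<alpha>1)) - of_int w * (of_real \<beta> + \<alpha>1)"
      by simp
    also have "norm \<dots> \<le> norm (of_int v + of_int w * (of_real \<beta> + \<alpha>1)) + norm (of_int w * (of_real \<beta> + \<alpha>1))"
      by (rule norm_triangle_ineq4)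
    also have "\<dots> \<le> V"
      unfolding V_def norm_mult using d1 w by (intro add_mono mult_right_mono) auto
    finally have v: "\<bar>real_of_int v\<bar> \<le> V" by simp
    have "\<bar>of_int v * \<beta>\<bar> \<le> V * \<beta>" "\<bar>of_int w * \<beta>\<^sup>2\<bar> \<le> W * \<beta>\<^sup>2"
      using v w gt1 by (auto simp: abs_mult intro!: mult_right_mono)
    with x have "\<bar>real_of_int u\<bar> \<le> U" unfolding U_def by linarith
    with v w show ?thesis by blast
  qed
  show ?thesis
  proof (rule exI[of _ "\<lfloor>max U (max V W)\<rfloor>"], intro allI impI)
    fix u v w :: int
    assume "\<bar>of_int u + of_int v * \<beta> + of_int w * \<beta>\<^sup>2\<bar> \<le> B"
      "norm (of_int u + of_int v * \<alpha>1 + of_int w * \<alpha>1\<^sup>2) \<le> B"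
      "norm (of_int u + of_int v * \<alpha>2 + of_int w * \<alpha>2\<^sup>2) \<le> B"
    from main[OF this] show "\<bar>u\<bar> \<le> \<lfloor>max U (max V W)\<rfloor> \<and> \<bar>v\<bar> \<le> \<lfloor>max U (max V W)\<rfloor> \<and> \<bar>w\<bar> \<le> \<lfloor>max U (max V W)\<rfloor>"
      by (auto simp: le_floor_iff le_max_iff_disj)
  qed
qed

lemma finite_bounded_conj:
  "finite {x. \<exists>y z. Zel x y z \<and> \<bar>x\<bar> \<le> B \<and> norm y \<le> B \<and> norm z \<le> B}" (is "finite ?S")
proof -
  obtain M where M: "\<And>u v w :: int.
     \<bar>of_int u + of_int v * \<beta> + of_int w * \<beta>\<^sup>2\<bar> \<le> B \<Longrightarrow>
     norm (of_int u + of_int v * \<alpha>1 + of_int w * \<alpha>1\<^sup>2) \<le> B \<Longrightarrow>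
     norm (of_int u + of_int v * \<alpha>2 + of_int w * \<alpha>2\<^sup>2) \<le> B \<Longrightarrow>
     \<bar>u\<bar> \<le> M \<and> \<bar>v\<bar> \<le> M \<and> \<bar>w\<bar> \<le> M"
    using coord_bound[of B] by blast
  let ?f = "\<lambda>(u :: int, v :: int, w :: int). of_int u + of_int v * \<beta> + of_int w * \<beta>\<^sup>2"
  have "?S \<subseteq> ?f ` ({-M..M} \<times> {-M..M} \<times> {-M..M})"
  proof
    fix x assume "x \<in> ?S"
    then obtain u v w :: int where x: "x = of_int u + of_int v * \<beta> + of_int w * \<beta>\<^sup>2"
      "\<bar>u\<bar> \<le> M \<and> \<bar>v\<bar> \<le> M \<and> \<bar>w\<bar> \<le> M"
      unfolding Zel_def using M by blast
    show "x \<in> ?f ` ({-M..M} \<times> {-M..M} \<times> {-M..M})"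
      by (rule image_eqI[of _ _ "(u, v, w)"]) (use x in auto)
  qed
  then show ?thesis by (rule finite_subset) auto
qed

text \<open>Positive elements up to 1 with bounded conjugates form a finite set by
  \<open>finite_bounded_conj\<close>, so they stay away from 0.\<close>

lemma positive_gap:
  "\<exists>\<epsilon>>0. \<forall>x y z. Zel x y z \<longrightarrow> 0 < x \<longrightarrow> norm y \<le> B \<longrightarrow> norm z \<le> B \<longrightarrow> \<epsilon> < x"
proof -
  define S where "S = {x. \<exists>y z. Zel x y z \<and> \<bar>x\<bar> \<le> max B 1 \<and> norm y \<le> max B 1 \<and> norm z \<le> max B 1} \<inter> {0<..}"
  have fin: "finite S" unfolding S_def using finite_bounded_conj by blast
  \<comment> \<open>Inserting 1 makes the set nonempty and covers the elements above 1.\<close>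
  define e where "e = Min (insert 1 S)"
  have "e \<in> insert 1 S" unfolding e_def using fin by (intro Min_in) auto
  then have "e > 0" by (auto simp: S_def)
  moreover have "e / 2 < x" if "Zel x y z" "0 < x" "norm y \<le> B" "norm z \<le> B" for x y z
  proof -
    have le: "e \<le> t" if "t \<in> insert 1 S" for t
      unfolding e_def using fin that by (intro Min_le) auto
    have "e \<le> x"
    proof (cases "x \<le> 1")
      case True
      then have "x \<in> S" using that by (auto simp: S_def le_max_iff_disj)
      then show ?thesis using le by blast
    next
      case False
      then show ?thesis using le[of 1] by simp
    qed
    then show ?thesis using \<open>e > 0\<close> by linarith
  qed
  ultimately show ?thesis by (intro exI[of _ "e / 2"]) auto
qed

end

locale cubic_unit = cubic +
  assumes unit: "\<bar>c\<bar> = 1"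
begin

lemma c_sq: "c * c = 1"
  using unit by (metis abs_mult_self_eq mult_1)

lemma c_nz: "c \<noteq> 0" using unit by auto

lemma conj_nz: "\<alpha>1 \<noteq> 0" "\<alpha>2 \<noteq> 0"
proof -
  have "complex_of_real \<beta> * (\<alpha>1 * \<alpha>2) = of_int c"
    unfolding prod_conj using arg_cong[OF c_eq, of complex_of_real] by simp
  with c_nz show "\<alpha>1 \<noteq> 0" "\<alpha>2 \<noteq> 0" by auto
qed

text \<open>For a root \<open>t\<close> of the cubic, \<open>c * c = 1\<close> makes
  \<open>c * (t\<^sup>2 - a * t - b)\<close> the inverse of \<open>t\<close>.\<close>

lemma Zel_div_beta:
  assumes "Zel x y z"
  shows "Zel (x / \<beta>) (y / \<alpha>1) (z / \<alpha>2)"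
proof -
  from assms obtain u v w :: int where 1:
    "x = of_int u + of_int v * \<beta> + of_int w * \<beta>\<^sup>2"
    "y = of_int u + of_int v * \<alpha>1 + of_int w * \<alpha>1\<^sup>2"
    "z = of_int u + of_int v * \<alpha>2 + of_int w * \<alpha>2\<^sup>2" unfolding Zel_def by blast
  have *: "(of_int u + of_int v * t + of_int w * t\<^sup>2) / t =
      of_int (v - u * c * b) + of_int (w - u * c * a) * t + of_int (u * c) * t\<^sup>2"
    if "t \<noteq> 0" "t ^ 3 = of_int a * t\<^sup>2 + of_int b * t + of_int c" for t :: "'t :: field"
  proof -
    have "(of_int (v - u * c * b) + of_int (w - u * c * a) * t + of_int (u * c) * t\<^sup>2) * t =
       of_int v * t + of_int w * t\<^sup>2 + of_int u * of_int c * (t ^ 3 - of_int a * t\<^sup>2 - of_int b * t)"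
      by (simp add: algebra_simps power2_eq_square power3_eq_cube)
    also have "\<dots> = of_int v * t + of_int w * t\<^sup>2 + of_int (u * (c * c))"
      unfolding that by (simp add: algebra_simps)
    finally show ?thesis using that(1) unfolding c_sq by (simp add: field_simps)
  qed
  show ?thesis
    using cubic_eq conj_cubic[of \<alpha>1] conj_cubic[of \<alpha>2] conj_nz gt1
    by (intro ZelI[of _ "v - u * c * b" "w - u * c * a" "u * c"]; unfold 1; intro *) auto
qed

lemma Zel_div_power: "Zel x y z \<Longrightarrow> Zel (x / \<beta> ^ n) (y / \<alpha>1 ^ n) (z / \<alpha>2 ^ n)"
proof (induction n)
  case (Suc n)
  then show ?case using Zel_div_beta[of "x / \<beta> ^ n" "y / \<alpha>1 ^ n" "z / \<alpha>2 ^ n"]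
    by (simp add: mult.commute)
qed simp

text \<open>For a unit, adjoining \<open>\<beta>\<close> or \<open>1 / \<beta>\<close> gives the
  same ring: division by \<open>\<beta>\<close> preserves \<open>Zel\<close>, and conversely the
  cubic writes \<open>\<beta>\<close> as
  \<open>a + b / \<beta> + c / \<beta>\<^sup>2\<close>.\<close>

lemma Z_inverse_iff: "x \<in> Z_inverse \<beta> \<longleftrightarrow> (\<exists>y z. Zel x y z)"
proof
  assume "x \<in> Z_inverse \<beta>"
  then obtain p :: "int poly" where x: "x = poly (map_poly of_int p) (1 / \<beta>)"
    unfolding Z_inverse_def by blast
  have "\<exists>y z. Zel (poly (map_poly of_int p) (1 / \<beta>)) y z"
  proof (induction p)
    case (pCons k p)
    then obtain y z where "Zel (poly (map_poly of_int p) (1 / \<beta>)) y z" by blast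
    from Zel_add[OF Zel_of_int[of k] Zel_div_beta[OF this]]
    show ?case by (auto simp: map_poly_pCons)
  qed (auto intro: Zel_0)
  then show "\<exists>y z. Zel x y z" by (simp add: x)
next
  assume "\<exists>y z. Zel x y z"
  then obtain u v w :: int where x: "x = of_int u + of_int v * \<beta> + of_int w * \<beta>\<^sup>2"
    unfolding Zel_def by blast
  have b1: "\<beta> = a + b * (1 / \<beta>) + c * (1 / \<beta>)\<^sup>2"
    unfolding c_eq using gt1 by (simp add: field_simps power2_eq_square)
  have b2: "\<beta>\<^sup>2 = a * \<beta> + b + c * (1 / \<beta>)"
    unfolding c_eq using gt1 by (simp add: field_simps power2_eq_square)
  define t where "t = 1 / \<beta>"
  have "x = of_int u + of_int v * (a + b * t + c * t\<^sup>2) + of_int w * (a * (a + b * t + c * t\<^sup>2) + b + c * t)"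
    using x b1 b2 unfolding t_def by metis
  also have "\<dots> = poly (map_poly of_int [:u + v * a + w * (a * a + b), v * b + w * (a * b + c), v * c + w * a * c:]) t"
    by (simp add: map_poly_pCons algebra_simps power2_eq_square)
  finally show "x \<in> Z_inverse \<beta>" unfolding Z_inverse_def t_def by blast
qed

end

section \<open>Cubic Pisot units\<close>

locale cubic_pisot = cubic_unit +
  assumes conj_lt_1: "norm \<alpha>1 < 1" "norm \<alpha>2 < 1"
begin

definition digit_bound :: real where
  "digit_bound = max (\<beta> / (1 - norm \<alpha>1)) (\<beta> / (1 - norm \<alpha>2))"

lemma norm_digit_sum_conj:
  assumes "0 \<le> x" "x < 1"
  shows "norm (digit_sum \<alpha>1 x n) \<le> digit_bound" "norm (digit_sum \<alpha>2 x n) \<le> digit_bound"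
  using norm_digit_sum_le[OF assms conj_lt_1(1)] norm_digit_sum_le[OF assms conj_lt_1(2)]
  unfolding digit_bound_def by (meson max.cobounded1 max.cobounded2 order_trans)+

lemma digit_bound_nonneg: "0 \<le> digit_bound"
  using norm_digit_sum_conj(1)[of 0 0] by simp

text \<open>Division by \<open>\<beta> ^ N\<close> brings \<open>m\<close> into [0,1), so
  \<open>f\<close> is the fractional part of \<open>m\<close>; it differs from \<open>m\<close> by a
  digit sum, whose conjugates are bounded.\<close>

lemma fractional_part_conj:
  assumes "Zel m y z" "0 \<le> m" "m < \<beta> ^ N"
  defines "f \<equiv> (T ^^ N) (m / \<beta> ^ N)"
  obtains y' z' where "Zel f y' z'" "norm y' \<le> norm y + digit_bound" "norm z' \<le> norm z + digit_bound"
    "0 \<le> f" "f < 1"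
proof -
  let ?x = "m / \<beta> ^ N"
  have p: "\<beta> ^ N > 0" using gt1 by simp
  have x: "0 \<le> ?x" "?x < 1" using assms p by auto
  have "f = m - digit_sum \<beta> ?x N"
    using power_eq_digit_sum[of N ?x] gt1 unfolding f_def by simp
  moreover have "Zel (m - digit_sum \<beta> ?x N) (y - digit_sum \<alpha>1 ?x N) (z - digit_sum \<alpha>2 ?x N)"
    using assms(1) Zel_digit_sum by (rule Zel_diff)
  moreover have "norm (y - digit_sum \<alpha>1 ?x N) \<le> norm y + digit_bound"
    "norm (z - digit_sum \<alpha>2 ?x N) \<le> norm z + digit_bound"
    using norm_digit_sum_conj[OF x] by (meson add_left_mono norm_triangle_ineq4 order_trans)+
  moreover have "0 \<le> f" "f < 1" unfolding f_def using T_funpow_range[OF x] by auto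
  ultimately show ?thesis using that by simp
qed

text \<open>Fractional parts of elements with small conjugates range over a finite set, so one bound on
  the preperiod serves all of them; dividing by powers of \<open>\<beta>\<close> then moves the preperiod to the left
  of the radix point.\<close>

lemma uniform_preperiod:
  assumes fixed: "\<And>x. x \<in> F \<Longrightarrow> T x = x"
    and ev: "\<And>x y z. Zel x y z \<Longrightarrow> 0 \<le> x \<Longrightarrow> x < 1 \<Longrightarrow> \<exists>k. (T ^^ k) x \<in> F"
  obtains \<delta> N0 where "\<delta> > 0" "L \<le> N0"
    "\<And>m y z N. Zel m y z \<Longrightarrow> 0 \<le> m \<Longrightarrow> norm y < \<delta> \<Longrightarrow> norm z < \<delta> \<Longrightarrow> m < \<beta> ^ N \<Longrightarrow> N0 \<le> N
      \<Longrightarrow> (T ^^ (N - L)) (m / \<beta> ^ N) \<in> F"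
proof -
  have stay: "(T ^^ n) x \<in> F" if "(T ^^ k) x \<in> F" "k \<le> n" for n k x
  proof -
    have "(T ^^ n) x = (T ^^ (n - k)) ((T ^^ k) x)"
      using that(2) by (simp flip: T_funpow_add)
    then show ?thesis using that(1) fixed T_funpow_fixed by metis
  qed
  define B where "B = 1 + digit_bound"
  define S where "S = {x. \<exists>y z. Zel x y z \<and> \<bar>x\<bar> \<le> B \<and> norm y \<le> B \<and> norm z \<le> B} \<inter> {0..<1}"
  have "finite S" unfolding S_def using finite_bounded_conj by blast
  have "\<forall>x\<in>S. \<exists>k. (T ^^ k) x \<in> F" using ev unfolding S_def by auto
  then obtain k where k: "\<And>x. x \<in> S \<Longrightarrow> (T ^^ k x) x \<in> F" by metis
  \<comment> \<open>The common preperiod of the finitely many possible fractional parts.\<close>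
  define J where "J = Max (insert 0 (k ` S))"
  have J: "(T ^^ J) x \<in> F" if "x \<in> S" for x
    using k[OF that] unfolding J_def by (rule stay) (use that \<open>finite S\<close> in auto)
  have main: "(T ^^ (N + J)) (m / \<beta> ^ N) \<in> F"
    if m: "Zel m y z" "0 \<le> m" "norm y \<le> 1" "norm z \<le> 1" "m < \<beta> ^ N" for m y z N
  proof -
    obtain y' z' where f: "Zel ((T ^^ N) (m / \<beta> ^ N)) y' z'"
      "norm y' \<le> norm y + digit_bound" "norm z' \<le> norm z + digit_bound"
      "0 \<le> (T ^^ N) (m / \<beta> ^ N)" "(T ^^ N) (m / \<beta> ^ N) < 1"
      by (rule fractional_part_conj[OF m(1,2,5)])
    then have "(T ^^ N) (m / \<beta> ^ N) \<in> S"
      using m digit_bound_nonneg unfolding S_def B_def by fastforce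
    from J[OF this] have "(T ^^ (J + N)) (m / \<beta> ^ N) \<in> F" by (simp only: T_funpow_add)
    then show ?thesis by (simp only: add.commute)
  qed
  \<comment> \<open>Chosen so that division by \<open>\<beta> ^ (J + L)\<close> still leaves
    conjugates of norm at most 1: \<open>J\<close> places absorb the preperiod and \<open>L\<close>
    places remain as slack.\<close>
  define \<delta> where "\<delta> = min (norm \<alpha>1 ^ (J + L)) (norm \<alpha>2 ^ (J + L))"
  have "\<delta> > 0" unfolding \<delta>_def using conj_nz by simp
  moreover have "(T ^^ (N - L)) (m / \<beta> ^ N) \<in> F"
    if m: "Zel m y z" "0 \<le> m" "norm y < \<delta>" "norm z < \<delta>" "m < \<beta> ^ N" "J + L \<le> N" for m y z N
  proof -
    let ?m = "m / \<beta> ^ (J + L)" let ?N = "N - (J + L)"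
    have e: "\<beta> ^ N = \<beta> ^ (J + L) * \<beta> ^ ?N" using m(6) by (simp flip: power_add)
    have "Zel ?m (y / \<alpha>1 ^ (J + L)) (z / \<alpha>2 ^ (J + L))" by (rule Zel_div_power[OF m(1)])
    moreover have "0 \<le> ?m" using m(2) gt1 by simp
    moreover have "norm (y / \<alpha>1 ^ (J + L)) \<le> 1" "norm (z / \<alpha>2 ^ (J + L)) \<le> 1"
      using m(3,4) conj_nz by (auto simp: \<delta>_def norm_divide norm_power divide_simps)
    moreover have "?m < \<beta> ^ ?N"
      using m(5) gt1 unfolding e by (simp add: divide_simps mult.commute)
    ultimately have "(T ^^ (?N + J)) (?m / \<beta> ^ ?N) \<in> F" by (rule main)
    moreover have "?N + J = N - L" using m(6) by simp
    moreover have "?m / \<beta> ^ ?N = m / \<beta> ^ N" unfolding e by simp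
    ultimately show ?thesis by (simp only:)
  qed
  ultimately show thesis by (intro that[of \<delta> "J + L"]) auto
qed

text \<open>By the pigeonhole principle infinitely many powers of \<open>\<beta>\<close> have the
  same coordinates modulo \<open>q\<close>; the smaller of two such powers can be cancelled because
  \<open>\<beta>\<close> is a unit.\<close>

lemma power_cong_1:
  fixes q :: nat
  assumes "q > 0"
  shows "\<exists>n\<ge>N0. \<exists>(x :: real) y z. Zel x y z \<and> \<beta> ^ n - 1 = real q * x"
proof -
  have "\<forall>n. \<exists>u v w :: int. \<beta> ^ n = u + v * \<beta> + w * \<beta>\<^sup>2 \<and>
      \<alpha>1 ^ n = of_int u + of_int v * \<alpha>1 + of_int w * \<alpha>1\<^sup>2 \<and>
      \<alpha>2 ^ n = of_int u + of_int v * \<alpha>2 + of_int w * \<alpha>2\<^sup>2"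
    using Zel_power unfolding Zel_def by blast
  then obtain u v w :: "nat \<Rightarrow> int" where uvw: "\<And>n. \<beta> ^ n = u n + v n * \<beta> + w n * \<beta>\<^sup>2"
    by metis
  let ?f = "\<lambda>n. (u n mod int q, v n mod int q, w n mod int q)"
  have "range ?f \<subseteq> {0..<int q} \<times> {0..<int q} \<times> {0..<int q}"
    using assms by auto
  then have "finite (range ?f)" by (rule finite_subset) auto
  then obtain i where i: "infinite {n \<in> UNIV. ?f n = ?f i}"
    using pigeonhole_infinite[of UNIV ?f] by auto
  then obtain j where j: "j \<ge> i + N0" "?f j = ?f i"
    unfolding infinite_nat_iff_unbounded_le by blast
  from j(2) have "int q dvd u j - u i" "int q dvd v j - v i" "int q dvd w j - w i"
    by (simp_all add: mod_eq_dvd_iff)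
  then obtain u' v' w' :: int where d:
    "u j - u i = int q * u'" "v j - v i = int q * v'" "w j - w i = int q * w'"
    unfolding dvd_def by blast
  have "\<beta> ^ j - \<beta> ^ i = of_int (u j - u i) + of_int (v j - v i) * \<beta> + of_int (w j - w i) * \<beta>\<^sup>2"
    unfolding uvw[of i] uvw[of j] by (simp add: algebra_simps)
  also have "\<dots> = q * (of_int u' + of_int v' * \<beta> + of_int w' * \<beta>\<^sup>2)"
    unfolding d by (simp add: algebra_simps)
  finally have "\<beta> ^ j - \<beta> ^ i = q * (of_int u' + of_int v' * \<beta> + of_int w' * \<beta>\<^sup>2)" .
  moreover have "\<beta> ^ j = \<beta> ^ i * \<beta> ^ (j - i)" using j(1) by (simp flip: power_add)
  ultimately have "\<beta> ^ (j - i) - 1 = q * ((of_int u' + of_int v' * \<beta> + of_int w' * \<beta>\<^sup>2) / \<beta> ^ i)"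
    using gt1 by (simp add: field_simps)
  moreover have "Zel (of_int u' + of_int v' * \<beta> + of_int w' * \<beta>\<^sup>2)
      (of_int u' + of_int v' * \<alpha>1 + of_int w' * \<alpha>1\<^sup>2) (of_int u' + of_int v' * \<alpha>2 + of_int w' * \<alpha>2\<^sup>2)"
    by (rule ZelI) auto
  ultimately show ?thesis using Zel_div_power[of _ _ _ i] j(1)
    by (intro exI[of _ "j - i"]) fastforce
qed

lemma small_rationals_periodic:
  assumes F: "\<And>x y z. Zel x y z \<Longrightarrow> 0 \<le> x \<Longrightarrow> x < 1 \<Longrightarrow> \<exists>k. (T ^^ k) x = 0"
  shows "gamma \<beta> > 0"
proof -
  obtain \<delta> N0 where \<delta>: "\<delta> > 0" and N0: "\<And>m y z N. Zel m y z \<Longrightarrow> 0 \<le> m \<Longrightarrow>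
      norm y < \<delta> \<Longrightarrow> norm z < \<delta> \<Longrightarrow> m < \<beta> ^ N \<Longrightarrow> N0 \<le> N \<Longrightarrow> (T ^^ N) (m / \<beta> ^ N) = 0"
    by (rule uniform_preperiod[of "{0}" 0]) (use F in auto)
  obtain \<epsilon> where \<epsilon>: "\<epsilon> > 0"
    "\<And>x y z. Zel x y z \<Longrightarrow> 0 < x \<Longrightarrow> norm y \<le> 1 + digit_bound \<Longrightarrow> norm z \<le> 1 + digit_bound \<Longrightarrow> \<epsilon> < x"
    using positive_gap[of "1 + digit_bound"] by blast
  \<comment> \<open>The conjugates of \<open>(\<beta> ^ n - 1) * x\<close> have norm at most
    \<open>2 * x\<close>, hence the bound \<open>c < \<delta> / 2\<close>; the bound by
    \<open>\<epsilon>\<close> will exclude carries.\<close>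
  define c where "c = min (min (\<delta> / 3) \<epsilon>) (1 / 2)"
  have c: "c > 0" "c < 1" "c < \<delta> / 2" "c \<le> \<epsilon>" using \<delta> \<epsilon>(1) by (auto simp: c_def min_def)
  have "\<exists>p>0. (T ^^ p) x = x" if x: "x \<in> \<rat>" "0 \<le> x" "x \<le> c" for x
  proof -
    obtain p q :: nat where pq: "q > 0" "x = p / q" using Rats_nonneg_cases x by blast
    obtain n e e1 e2 where n: "n \<ge> Suc N0" "Zel e e1 e2" "\<beta> ^ n - 1 = real q * e"
      using power_cong_1[OF pq(1)] by blast
    define m where "m = real_of_int (int p) * e"
    have Zm: "Zel m (of_int (int p) * e1) (of_int (int p) * e2)" unfolding m_def by (rule Zel_mult_int[OF n(2)])
    have m: "m = (\<beta> ^ n - 1) * x" using pq n(3) by (simp add: m_def)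
    have Zn: "Zel (\<beta> ^ n - 1) (\<alpha>1 ^ n - 1) (\<alpha>2 ^ n - 1)" by (intro Zel_diff Zel_power Zel_1)
    have "q * m = p * (\<beta> ^ n - 1)" unfolding m pq using pq(1) by simp
    from Zel_mult_rat[OF Zm Zn pq(1) this]
    have y: "of_int (int p) * e1 = of_real x * (\<alpha>1 ^ n - 1)" and z: "of_int (int p) * e2 = of_real x * (\<alpha>2 ^ n - 1)"
      by (simp_all add: pq)
    have small: "norm (of_real x * (\<alpha> ^ n - 1)) < \<delta>" if "norm \<alpha> < 1" for \<alpha> :: complex
    proof -
      have "norm (\<alpha> ^ n) \<le> 1" using that by (simp add: norm_power power_le_one)
      then have "norm (\<alpha> ^ n - 1) \<le> 2" using norm_triangle_ineq4[of "\<alpha> ^ n" 1] by simp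
      then have "norm (of_real x * (\<alpha> ^ n - 1)) \<le> x * 2"
        using x(2) by (simp add: norm_mult mult_left_mono)
      then show ?thesis using c x(3) by linarith
    qed
    have p1: "\<beta> ^ n \<ge> 1" using gt1 by (simp add: one_le_power)
    have m0: "0 \<le> m" unfolding m using p1 x by simp
    have mn: "m < \<beta> ^ n"
    proof -
      have "m \<le> (\<beta> ^ n - 1) * 1" unfolding m using p1 x c by (intro mult_left_mono) auto
      then show ?thesis by simp
    qed
    have fin: "(T ^^ n) (m / \<beta> ^ n) = 0"
      using N0[OF Zm m0 _ _ mn] y z small conj_lt_1 n(1) by simp
    define y0 where "y0 = m / \<beta> ^ n"
    have y0: "0 \<le> y0" "y0 < 1" unfolding y0_def using m0 mn p1 by auto
    \<comment> \<open>\<open>x\<close> is the finite expansion of \<open>y0\<close> followed by a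
      copy of \<open>x\<close> shifted by \<open>n\<close> places; it remains to see that adding the
      copy causes no carry.\<close>
    have "(T ^^ n) x = (T ^^ n) y0 + x"
    proof (rule T_funpow_add_small)
      show "0 \<le> x" "0 \<le> y0" using x y0 by auto
      show "x = y0 + x / \<beta> ^ n" unfolding y0_def m using gt1 by (simp add: field_simps)
      fix i assume i: "i \<le> n"
      let ?t = "(T ^^ i) y0" let ?k = "n - i"
      have t: "0 \<le> ?t" "?t < 1" using T_funpow_range y0 by auto
      have pk: "\<beta> ^ ?k > 0" using gt1 by simp
      have "(T ^^ ?k) ?t = 0" using fin i by (simp add: y0_def flip: T_funpow_add)
      \<comment> \<open>The remaining tail is finite of length \<open>?k\<close>, so its distance
        from 1, scaled by \<open>\<beta> ^ ?k\<close>, is a positive ring element with bounded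
        conjugates and \<open>positive_gap\<close> applies.\<close>
      then have dt: "\<beta> ^ ?k * ?t = digit_sum \<beta> ?t ?k" by (simp add: power_eq_digit_sum)
      have "\<epsilon> < \<beta> ^ ?k - digit_sum \<beta> ?t ?k"
      proof (rule \<epsilon>(2))
        show "Zel (\<beta> ^ ?k - digit_sum \<beta> ?t ?k) (\<alpha>1 ^ ?k - digit_sum \<alpha>1 ?t ?k) (\<alpha>2 ^ ?k - digit_sum \<alpha>2 ?t ?k)"
          by (intro Zel_diff Zel_power Zel_digit_sum)
        show "0 < \<beta> ^ ?k - digit_sum \<beta> ?t ?k" unfolding dt[symmetric] using t pk by simp
        have *: "norm (\<alpha> ^ ?k - d) \<le> 1 + digit_bound" if "norm \<alpha> < 1" "norm d \<le> digit_bound"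
          for \<alpha> d :: complex
        proof -
          have "norm (\<alpha> ^ ?k) \<le> 1" using that by (simp add: norm_power power_le_one)
          then show ?thesis using that norm_triangle_ineq4[of "\<alpha> ^ ?k" d] by linarith
        qed
        show "norm (\<alpha>1 ^ ?k - digit_sum \<alpha>1 ?t ?k) \<le> 1 + digit_bound"
          "norm (\<alpha>2 ^ ?k - digit_sum \<alpha>2 ?t ?k) \<le> 1 + digit_bound"
          using * conj_lt_1 norm_digit_sum_conj[OF t] by auto
      qed
      then have "x < \<beta> ^ ?k - \<beta> ^ ?k * ?t" unfolding dt using x c by linarith
      then have "x < (1 - ?t) * \<beta> ^ ?k" by (simp add: algebra_simps)
      then have "x / \<beta> ^ ?k < 1 - ?t" by (simp only: pos_divide_less_eq[OF pk])
      then show "?t + x / \<beta> ^ ?k < 1" by simp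
    qed
    then show ?thesis using fin n(1) by (intro exI[of _ n]) (auto simp: y0_def)
  qed
  then show ?thesis unfolding gamma_pos_iff using c by (intro exI[of _ c]) auto
qed

lemma property_F_iff:
  "property_F \<beta> \<longleftrightarrow> (\<forall>x y z. Zel x y z \<longrightarrow> 0 \<le> x \<longrightarrow> x < 1 \<longrightarrow> (\<exists>k. (T ^^ k) x = 0))"
proof -
  have "property_F \<beta> \<longleftrightarrow> (\<forall>x. x \<in> Z_inverse \<beta> \<longrightarrow> 0 \<le> x \<and> x < 1 \<longrightarrow> (\<exists>k. (T ^^ k) x = 0))"
    unfolding property_F_def using finite_expansion_iff by auto
  then show ?thesis unfolding Z_inverse_iff by blast
qed

end

section \<open>Shift radix systems\<close>

definition srs :: "real \<Rightarrow> real \<Rightarrow> int \<times> int \<Rightarrow> int \<times> int" where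
  "srs r0 r1 v = (snd v, - \<lfloor>r0 * fst v + r1 * snd v\<rfloor>)"

lemma srs_eqI:
  assumes "0 \<le> r0 * of_int p + r1 * of_int q + of_int k" "r0 * of_int p + r1 * of_int q + of_int k < 1"
  shows "srs r0 r1 (p, q) = (q, k)"
proof -
  have "\<lfloor>r0 * of_int p + r1 * of_int q\<rfloor> = - k"
    using assms by (intro floor_unique) auto
  then show ?thesis by (simp add: srs_def)
qed

text \<open>Brunotte's argument: one step applied to \<open>z + v\<close> and to \<open>z\<close> differs by \<open>srs v\<close> or
  \<open>- srs (- v)\<close>, so a symmetric forward-invariant set \<open>V\<close> of differences is never left.\<close>

lemma brunotte:
  fixes V K :: "(int \<times> int) set" and r0 r1 :: real
  defines "\<tau> \<equiv> srs r0 r1"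
  assumes V: "\<And>v. v \<in> V \<Longrightarrow> \<tau> v \<in> V" "\<And>v. v \<in> V \<Longrightarrow> - v \<in> V" "(1, 0) \<in> V" "(0, 1) \<in> V"
    and K: "(0, 0) \<in> K" "\<And>k v. k \<in> K \<Longrightarrow> v \<in> V \<Longrightarrow> \<exists>n. (\<tau> ^^ n) (k + v) \<in> K"
  shows "\<exists>n. (\<tau> ^^ n) z \<in> K"
proof -
  have step: "\<exists>v'\<in>V. \<tau> (z + v) = \<tau> z + v'" if "v \<in> V" for z v
  proof -
    obtain z0 z1 v0 v1 where z: "z = (z0, z1)" and v: "v = (v0, v1)" by (cases z, cases v)
    let ?s = "r0 * z0 + r1 * z1" and ?t = "r0 * v0 + r1 * v1"
    have e: "r0 * of_int (z0 + v0) + r1 * of_int (z1 + v1) = ?s + ?t"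
      by (simp add: algebra_simps)
    have "\<lfloor>?s + ?t\<rfloor> = \<lfloor>?s\<rfloor> + \<lfloor>?t\<rfloor> \<or> \<lfloor>?s + ?t\<rfloor> = \<lfloor>?s\<rfloor> - \<lfloor>- ?t\<rfloor>"
      by linarith
    then have "\<tau> (z + v) = \<tau> z + \<tau> v \<or> \<tau> (z + v) = \<tau> z + (- \<tau> (- v))"
      unfolding \<tau>_def srs_def z v by (auto simp: e) (auto simp: algebra_simps)
    then show ?thesis using V(1,2) that by blast
  qed
  have steps: "\<exists>v'\<in>V. (\<tau> ^^ n) (z + v) = (\<tau> ^^ n) z + v'" if "v \<in> V" for n z v
    using that
  proof (induction n)
    case (Suc n)
    then obtain v' where "v' \<in> V" "(\<tau> ^^ n) (z + v) = (\<tau> ^^ n) z + v'" by blast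
    then show ?case using step[of v' "(\<tau> ^^ n) z"] by auto
  qed auto
  define P where "P z \<longleftrightarrow> (\<exists>n. (\<tau> ^^ n) z \<in> K)" for z
  \<comment> \<open>The orbits of \<open>z + v\<close> and \<open>z\<close> differ by elements of
    \<open>V\<close>; once the orbit of \<open>z\<close> is in \<open>K\<close>, the second
    hypothesis on \<open>K\<close> finishes.\<close>
  have add: "P (z + v)" if "P z" "v \<in> V" for z v
  proof -
    obtain n where n: "(\<tau> ^^ n) z \<in> K" using \<open>P z\<close> P_def by blast
    obtain v' where v': "v' \<in> V" "(\<tau> ^^ n) (z + v) = (\<tau> ^^ n) z + v'" using steps[OF \<open>v \<in> V\<close>] by blast
    then obtain m where "(\<tau> ^^ m) ((\<tau> ^^ n) (z + v)) \<in> K" using K(2)[OF n v'(1)] by auto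
    then have "(\<tau> ^^ (m + n)) (z + v) \<in> K" by (simp add: funpow_add)
    then show ?thesis unfolding P_def by blast
  qed
  have "P (0, 0)" unfolding P_def using K(1) by (intro exI[of _ 0]) auto
  \<comment> \<open>Every vector is reached from the origin by adding unit vectors and their
    negatives, all of which lie in \<open>V\<close>.\<close>
  have 1: "P (0, q)" for q
  proof (induction q rule: int_induct[where k = 0])
    case base
    show ?case by fact
  next
    case (step1 i)
    show ?case using add[OF step1(2) V(4)] by simp
  next
    case (step2 i)
    show ?case using add[OF step2(2) V(2)[OF V(4)]] by simp
  qed
  have "P (p, q)" for p q
  proof (induction p rule: int_induct[where k = 0])
    case base
    show ?case by (rule 1)
  next
    case (step1 i)
    show ?case using add[OF step1(2) V(3)] by simp
  next
    case (step2 i)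
    show ?case using add[OF step2(2) V(2)[OF V(3)]] by simp
  qed
  then show ?thesis unfolding P_def by (metis surj_pair)
qed

text \<open>Separates inequalities from computation: the real parameters enter only through the
  hypothesis on \<open>f\<close>, and for finite \<open>V\<close> the other hypotheses can be
  decided by evaluation.\<close>

lemma srs_finite:
  fixes V :: "(int \<times> int) set" and f :: "int \<Rightarrow> int \<Rightarrow> int"
  assumes f: "\<forall>(p, q)\<in>V. 0 \<le> r0 * of_int p + r1 * of_int q + of_int (f p q) \<and>
      r0 * of_int p + r1 * of_int q + of_int (f p q) < 1"
    and V: "\<forall>(p, q)\<in>V. (q, f p q) \<in> V \<and> (- p, - q) \<in> V" "(1, 0) \<in> V" "(0, 1) \<in> V"
    and stop: "\<forall>v\<in>V. ((\<lambda>(p, q). (q, f p q)) ^^ n) v = (0, 0)"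
  shows "\<exists>n. (srs r0 r1 ^^ n) z = (0, 0)"
proof -
  have srs: "srs r0 r1 (p, q) = (q, f p q)" if "(p, q) \<in> V" for p q
    using f that by (intro srs_eqI) auto
  have "\<exists>n. (srs r0 r1 ^^ n) z \<in> {(0, 0)}"
  proof (rule brunotte[where V = V])
    show "srs r0 r1 v \<in> V" if "v \<in> V" for v using V(1) srs that by (cases v) auto
    show "- v \<in> V" if "v \<in> V" for v using V(1) that by (cases v) auto
    have "v \<in> V \<Longrightarrow> (srs r0 r1 ^^ i) v = ((\<lambda>(p, q). (q, f p q)) ^^ i) v \<and> (srs r0 r1 ^^ i) v \<in> V" for i v
    proof (induction i)
      case (Suc i)
      then have IH: "(srs r0 r1 ^^ i) v = ((\<lambda>(p, q). (q, f p q)) ^^ i) v" "(srs r0 r1 ^^ i) v \<in> V" by auto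
      obtain p q where pq: "(srs r0 r1 ^^ i) v = (p, q)" by (cases "(srs r0 r1 ^^ i) v")
      then show ?case using IH srs[of p q] V(1) by auto
    qed auto
    then show "\<exists>m. (srs r0 r1 ^^ m) (k + v) \<in> {(0, 0)}" if "k \<in> {(0, 0)}" "v \<in> V" for k v
      using stop that by (intro exI[of _ n]) (auto simp flip: zero_prod_def)
  qed (use V in auto)
  then show ?thesis by simp
qed

section \<open>Cubic Pisot units of norm 1\<close>

locale cubic_pisot1 = cubic_pisot +
  assumes c1: "c = 1"
begin

text \<open>\<open>X^2 + r1 X + r0\<close> is the cubic divided by \<open>X - \<beta>\<close>; its
  constant term is \<open>1 / \<beta>\<close> because the norm is 1.\<close>

definition r0 :: real where "r0 = 1 / \<beta>"
definition r1 :: real where "r1 = \<beta> - a"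

lemma r0_eq: "r0 = \<beta>\<^sup>2 - a * \<beta> - b"
  using c_eq gt1 unfolding c1 r0_def by (simp add: field_simps)

lemma r0_range: "0 < r0" "r0 < 1" using gt1 by (auto simp: r0_def)

lemma beta_r1: "\<beta> * r1 = b + r0"
  unfolding r0_eq r1_def by (simp add: algebra_simps power2_eq_square)

lemma r1_eq: "r1 = b * r0 + r0 * r0"
  using beta_r1 gt1 unfolding r0_def by (simp add: field_simps)

definition phi :: "int \<times> int \<Rightarrow> real" where "phi v = r0 * fst v + r1 * snd v"

text \<open>By \<open>\<beta> * r0 = 1\<close>, \<open>\<beta> * r1 = b + r0\<close> and
  \<open>\<beta> = a + r1\<close>, multiplying \<open>phi (p, q) + k\<close> by
  \<open>\<beta>\<close> gives \<open>phi (q, k)\<close> up to an integer. Thus \<open>srs\<close>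
  models \<open>T\<close>.\<close>

lemma T_frac_phi: "T (frac (phi v)) = frac (phi (srs r0 r1 v))"
proof -
  obtain p q where v: "v = (p, q)" by (cases v)
  define k where "k = - \<lfloor>phi v\<rfloor>"
  have s: "srs r0 r1 v = (q, k)" by (simp add: v k_def srs_def phi_def)
  have "\<beta> * frac (phi v) = \<beta> * r0 * p + \<beta> * r1 * q + \<beta> * k"
    by (simp add: frac_def k_def v phi_def algebra_simps)
  also have "\<dots> = of_int (p + b * q + a * k + \<lfloor>phi (q, k)\<rfloor>) + frac (phi (q, k))"
    unfolding beta_r1 using gt1 by (simp add: frac_def phi_def r0_def r1_def algebra_simps)
  finally show ?thesis unfolding s by (rule T_unique) (auto simp: frac_lt_1)
qed

lemma T_funpow_frac_phi: "(T ^^ n) (frac (phi v)) = frac (phi ((srs r0 r1 ^^ n) v))"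
  by (induction n) (auto simp: T_frac_phi)

text \<open>The numbers 1, \<open>r1\<close> and \<open>r0\<close> form a basis of the ring over the
  integers; the constant coordinate disappears in the fractional part.\<close>

lemma Zel_frac_phi:
  assumes "Zel x y z" "0 \<le> x" "x < 1"
  shows "\<exists>v. x = frac (phi v)"
proof -
  obtain u v w :: int where x: "x = of_int u + of_int v * \<beta> + of_int w * \<beta>\<^sup>2"
    using assms(1) unfolding Zel_def by blast
  have "phi (w, v + a * w) = x + of_int (- u - v * a - w * (a * a + b))"
    unfolding phi_def r0_eq r1_def x by (simp add: algebra_simps power2_eq_square)
  then have "frac (phi (w, v + a * w)) = frac (x + of_int (- u - v * a - w * (a * a + b)))" by simp
  also have "\<dots> = x" unfolding frac_add_of_int_right using assms(2,3) by (simp add: frac_eq)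
  finally show ?thesis by metis
qed

lemma finite_if_srs_finite:
  assumes "\<And>v. \<exists>n. (srs r0 r1 ^^ n) v = (0, 0)" "Zel x y z" "0 \<le> x" "x < 1"
  shows "\<exists>n. (T ^^ n) x = 0"
proof -
  obtain v where v: "x = frac (phi v)" using Zel_frac_phi[OF assms(2-4)] by blast
  obtain n where "(srs r0 r1 ^^ n) v = (0, 0)" using assms(1) by blast
  then have "(T ^^ n) x = 0" unfolding v T_funpow_frac_phi by (simp add: phi_def)
  then show ?thesis ..
qed

text \<open>In each case the digit function of a sample rational parameter agrees on \<open>V\<close> with that of
  \<open>(r0, r1)\<close>.\<close>

lemma srs_finite_1_le_b_le_a:
  assumes "1 \<le> b" "b \<le> a"
  shows "\<exists>n. (srs r0 r1 ^^ n) z = (0, 0)"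
proof -
  have "r1 < 1"
  proof (rule ccontr)
    assume "\<not> r1 < 1"
    then have h: "a + 1 \<le> \<beta>" by (simp add: r1_def)
    have "(a + 1) * \<beta>\<^sup>2 \<le> \<beta> * \<beta>\<^sup>2" using h by (intro mult_right_mono) auto
    also have "\<dots> = a * \<beta>\<^sup>2 + b * \<beta> + 1" using cubic_eq c1 by (simp add: power2_eq_square power3_eq_cube)
    also have "b * \<beta> \<le> (\<beta> - 1) * \<beta>"
      using h assms gt1 by (intro mult_right_mono) auto
    finally show False using gt1 by (simp add: algebra_simps power2_eq_square)
  qed
  moreover have "r0 < r1"
  proof -
    have "r0 * 1 \<le> r0 * b" using r0_range assms by (intro mult_left_mono) auto
    moreover have "0 < r0 * r0" using r0_range by simp
    ultimately show ?thesis unfolding r1_eq by (simp add: mult.commute)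
  qed
  ultimately have bounds: "0 < r0" "r0 < r1" "r1 < 1" using r0_range by auto
  show ?thesis
    by (rule srs_finite[where n = 3 and f = "\<lambda>p q. - ((3 * p + 7 * q) div 10)"
        and V = "{(-1,0), (-1,1), (0,-1), (0,0), (0,1), (1,-1), (1,0)}"])
      ((use bounds in auto)[1], code_simp+)
qed

text \<open>Here \<open>r1 = r0 * r0\<close>, and \<open>2 \<le> a\<close> forces
  \<open>\<beta> > 2\<close>, whence \<open>r0 < 1 / 2\<close>.\<close>

lemma srs_finite_b_0:
  assumes "b = 0" "2 \<le> a"
  shows "\<exists>n. (srs r0 r1 ^^ n) z = (0, 0)"
proof -
  have "2 * \<beta>\<^sup>2 \<le> a * \<beta>\<^sup>2" using assms by (intro mult_right_mono) auto
  then have "2 * \<beta>\<^sup>2 < \<beta> * \<beta>\<^sup>2"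
    using cubic_eq c1 assms by (simp add: power2_eq_square power3_eq_cube)
  then have "\<beta> > 2" using gt1 by simp
  then have "r0 < 1 / 2" by (simp add: r0_def field_simps)
  moreover from this have "0 < r1" "r1 < r0 / 2"
    unfolding r1_eq using r0_range assms by (auto simp: field_simps)
  ultimately have bounds: "0 < r1" "r1 < r0 / 2" "r0 < 1 / 2" using r0_range by auto
  show ?thesis
    by (rule srs_finite[where n = 4 and f = "\<lambda>p q. - ((3 * p + q) div 10)"
        and V = "{(-1,-1), (-1,0), (-1,1), (0,-1), (0,0), (0,1), (1,-1), (1,0), (1,1)}"])
      ((use bounds in auto)[1], code_simp+)
qed

text \<open>Here \<open>r1 = r0 * r0 - r0\<close>, so that \<open>r0 - r1 < 1\<close> amounts to
  \<open>(1 - r0)\<^sup>2 > 0\<close>.\<close>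

lemma srs_finite_b_minus_1:
  assumes "b = -1"
  shows "\<exists>n. (srs r0 r1 ^^ n) z = (0, 0)"
proof -
  have "0 < r0 * r0" "r0 * r0 < r0" "0 < (1 - r0) * (1 - r0)" using r0_range by auto
  moreover have "(1 - r0) * (1 - r0) = 1 - 2 * r0 + r0 * r0" by (simp add: algebra_simps)
  moreover have "r1 = r0 * r0 - r0" unfolding r1_eq using assms by simp
  ultimately have "- r0 < r1" "r1 < 0" "r0 - r1 < 1" by auto
  then have bounds: "- r0 < r1" "r1 < 0" "r0 - r1 < 1" "0 < r0" "r0 < 1" using r0_range by auto
  show ?thesis
    by (rule srs_finite[where n = 5 and f = "\<lambda>p q. - ((4 * p - 2 * q) div 10)"
        and V = "{(-1,-1), (-1,0), (-1,1), (0,-1), (0,0), (0,1), (1,-1), (1,0), (1,1)}"])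
      ((use bounds in auto)[1], code_simp+)
qed

text \<open>The cubic equation factors as
  \<open>\<beta> * (\<beta> + 1) * (\<beta> - a - 1) = 1\<close>, which places \<open>r1\<close>
  slightly above 1.\<close>

lemma srs_finite_b_Suc_a:
  assumes "b = a + 1" "1 \<le> a"
  shows "\<exists>n. (srs r0 r1 ^^ n) z = (0, 0)"
proof -
  have "\<beta> * (\<beta> + 1) * (\<beta> - a - 1) = 1"
    using cubic_eq c1 assms by (simp add: power2_eq_square power3_eq_cube algebra_simps)
  then have "\<beta> - a - 1 = 1 / (\<beta> * (\<beta> + 1))"
    using gt1 by (simp add: eq_divide_eq mult.commute)
  then have e: "r1 = 1 + r0 / (\<beta> + 1)"
    unfolding r0_def r1_def by simp
  have "\<beta> > 2"
  proof (rule ccontr)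
    assume "\<not> \<beta> > 2"
    have "1 * \<beta>\<^sup>2 \<le> a * \<beta>\<^sup>2" "2 * \<beta> \<le> b * \<beta>" using assms gt1 by (auto intro!: mult_right_mono)
    moreover have "\<beta> * \<beta>\<^sup>2 = a * \<beta>\<^sup>2 + b * \<beta> + 1"
      using cubic_eq c1 by (simp add: power2_eq_square power3_eq_cube)
    moreover have "\<beta> * \<beta>\<^sup>2 \<le> 2 * \<beta>\<^sup>2" "\<beta> * \<beta> \<le> 2 * \<beta>"
      using \<open>\<not> \<beta> > 2\<close> gt1 by (auto intro!: mult_right_mono)
    ultimately show False by (simp add: power2_eq_square)
  qed
  then have "r0 < 1 / 2" "0 < r0 / (\<beta> + 1)"
    using r0_range by (auto simp: r0_def)
  moreover have "r0 / (\<beta> + 1) < r0 / 3"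
    using r0_range \<open>\<beta> > 2\<close> by (intro divide_strict_left_mono) auto
  ultimately have "r0 < 1 / 2" "1 < r1" "r1 < 1 + r0 / 3" unfolding e by auto
  then have bounds: "0 < r0" "r0 < 1 / 2" "1 < r1" "r1 < 1 + r0 / 3" using r0_range by auto
  show ?thesis
    by (rule srs_finite[where n = 5 and f = "\<lambda>p q. - ((25 * p + 105 * q) div 100)"
        and V = "{(-2,1), (-2,2), (-1,0), (-1,1), (-1,2), (0,-1), (0,0), (0,1), (1,-2), (1,-1), (1,0),
          (2,-2), (2,-1)}"])
      ((use bounds in auto)[1], code_simp+)
qed

text \<open>The single polynomial \<open>X^3 - X^2 - 1\<close>, treated by a numerical enclosure of
  its root.\<close>

lemma srs_finite_1_0:
  assumes "a = 1" "b = 0"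
  shows "\<exists>n. (srs r0 r1 ^^ n) z = (0, 0)"
proof -
  have e: "\<beta> * \<beta> * (\<beta> - 1) = 1"
    using cubic_eq c1 assms by (simp add: power2_eq_square power3_eq_cube algebra_simps)
  have lo: "\<beta> > 146 / 100"
  proof (rule ccontr)
    assume "\<not> \<beta> > 146 / 100"
    then have "\<beta> * \<beta> * (\<beta> - 1) \<le> (146 / 100) * (146 / 100) * (146 / 100 - 1)"
      using gt1 by (intro mult_mono) auto
    then show False unfolding e by simp
  qed
  have hi: "\<beta> < 147 / 100"
  proof (rule ccontr)
    assume "\<not> \<beta> < 147 / 100"
    then have "(147 / 100) * (147 / 100) * (147 / 100 - 1) \<le> \<beta> * \<beta> * (\<beta> - 1)"
      using gt1 by (intro mult_mono) auto
    then show False unfolding e by simp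
  qed
  have "r1 = \<beta> - 1" unfolding r1_def using assms by simp
  then have "r0 > 68 / 100" "r0 < 685 / 1000" "r1 > 46 / 100" "r1 < 47 / 100"
    using lo hi by (auto simp: r0_def field_simps)
  then have bounds: "r0 > 68 / 100" "r0 < 685 / 1000" "r1 > 46 / 100" "r1 < 47 / 100" by auto
  show ?thesis
    by (rule srs_finite[where n = 10 and f = "\<lambda>p q. - ((683 * p + 466 * q) div 1000)"
        and V = "{(-2,0), (-2,1), (-1,-1), (-1,0), (-1,1), (-1,2), (0,-2), (0,-1), (0,0), (0,1), (0,2),
          (1,-2), (1,-1), (1,0), (1,1), (2,-1), (2,0)}"])
      ((use bounds in auto)[1], code_simp+)
qed

text \<open>The single polynomial \<open>X^3 - X - 1\<close>, whose root is the smallest Pisot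
  number; the invariant set and the number of steps are accordingly large.\<close>

lemma srs_finite_0_1:
  assumes "a = 0" "b = 1"
  shows "\<exists>n. (srs r0 r1 ^^ n) z = (0, 0)"
proof -
  have e: "\<beta> * (\<beta> * \<beta> - 1) = 1"
    using cubic_eq c1 assms by (simp add: power2_eq_square power3_eq_cube algebra_simps)
  have lo: "\<beta> > 132 / 100"
  proof (rule ccontr)
    assume "\<not> \<beta> > 132 / 100"
    then have "\<beta> * (\<beta> * \<beta> - 1) \<le> (132 / 100) * ((132 / 100) * (132 / 100) - 1)"
      using gt1 mult_mono[of 1 \<beta> 1 \<beta>] by (intro mult_mono diff_mono) auto
    then show False unfolding e by simp
  qed
  have hi: "\<beta> < 133 / 100"
  proof (rule ccontr)
    assume "\<not> \<beta> < 133 / 100"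
    then have "(133 / 100) * ((133 / 100) * (133 / 100) - 1) \<le> \<beta> * (\<beta> * \<beta> - 1)"
      using gt1 by (intro mult_mono diff_mono) auto
    then show False unfolding e by simp
  qed
  have "r1 = \<beta>" unfolding r1_def using assms by simp
  then have "r0 > 75 / 100" "r0 < 758 / 1000" "r1 > 132 / 100" "r1 < 133 / 100"
    using lo hi by (auto simp: r0_def field_simps)
  then have bounds: "r0 > 75 / 100" "r0 < 758 / 1000" "r1 > 132 / 100" "r1 < 133 / 100" by auto
  show ?thesis
    by (rule srs_finite[where n = 16 and f = "\<lambda>p q. - ((755 * p + 1325 * q) div 1000)"
        and V = "{(-4,2), (-4,3), (-4,4), (-3,0), (-3,1), (-3,2), (-3,3), (-3,4), (-2,-1), (-2,0), (-2,1),
          (-2,2), (-2,3), (-1,-1), (-1,0), (-1,1), (-1,2), (-1,3), (0,-3), (0,-2), (0,-1), (0,0), (0,1),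
          (0,2), (0,3), (1,-3), (1,-2), (1,-1), (1,0), (1,1), (2,-3), (2,-2), (2,-1), (2,0), (2,1),
          (3,-4), (3,-3), (3,-2), (3,-1), (3,0), (4,-4), (4,-3), (4,-2)}"])
      ((use bounds in auto)[1], code_simp+)
qed

lemma srs_finite_akiyama:
  assumes "- 1 \<le> b" "b \<le> a + 1" "1 \<le> a + b"
  shows "\<exists>n. (srs r0 r1 ^^ n) z = (0, 0)"
proof -
  consider "b = -1" | "b = 0" "2 \<le> a" | "a = 1" "b = 0" | "1 \<le> b" "b \<le> a" | "b = a + 1" "1 \<le> a" | "a = 0" "b = 1"
    using assms by linarith
  then show ?thesis
    using srs_finite_b_minus_1 srs_finite_b_0 srs_finite_1_0 srs_finite_1_le_b_le_a srs_finite_b_Suc_a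
      srs_finite_0_1 by cases blast+
qed

end

section \<open>Coefficient inequalities and recurrence on the unit circle\<close>

context cubic_pisot
begin

text \<open>The expression is \<open>(1 - s * \<alpha>1) * (1 - s * \<alpha>2)\<close>, a product of
  two positive reals or of two complex conjugates.\<close>

lemma conj_prod_pos:
  assumes "s \<in> {1, -1 :: real}"
  shows "0 < 1 - s * (a - \<beta>) + (\<beta>\<^sup>2 - a * \<beta> - b)"
proof -
  have ss: "complex_of_real s * of_real s = 1" using assms by auto
  have "complex_of_real (1 - s * (a - \<beta>) + (\<beta>\<^sup>2 - a * \<beta> - b)) =
      1 - of_real s * (\<alpha>1 + \<alpha>2) + (of_real s * of_real s) * (\<alpha>1 * \<alpha>2)"
    unfolding ss sum_conj prod_conj by simp
  also have "\<dots> = (1 - of_real s * \<alpha>1) * (1 - of_real s * \<alpha>2)" by (simp add: algebra_simps)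
  finally have e: "1 - s * (a - \<beta>) + (\<beta>\<^sup>2 - a * \<beta> - b) = Re ((1 - of_real s * \<alpha>1) * (1 - of_real s * \<alpha>2))"
    by (metis Re_complex_of_real)
  have lt: "\<bar>Re \<alpha>\<bar> < 1" if "norm \<alpha> < 1" for \<alpha> using abs_Re_le_cmod[of \<alpha>] that by linarith
  have pos: "0 < 1 - s * Re \<alpha>" if "norm \<alpha> < 1" for \<alpha> using lt[OF that] assms by auto
  show ?thesis
  proof (cases "Im \<alpha>1 = 0 \<and> Im \<alpha>2 = 0")
    case True
    then show ?thesis unfolding e using pos[OF conj_lt_1(1)] pos[OF conj_lt_1(2)] by simp
  next
    case False
    then have "\<alpha>2 = cnj \<alpha>1" using conj_cases by (auto simp: complex_is_Real_iff)
    then have "Re ((1 - of_real s * \<alpha>1) * (1 - of_real s * \<alpha>2)) = (1 - s * Re \<alpha>1)\<^sup>2 + (s * Im \<alpha>1)\<^sup>2"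
      by (simp add: power2_eq_square)
    then show ?thesis unfolding e using pos[OF conj_lt_1(1)]
      by (simp add: add_pos_nonneg)
  qed
qed

text \<open>These are the signs of the cubic at 1 and -1, read off from its factorization.\<close>

lemma coeff_bounds: "1 < a + b + c" "b < a + c + 1"
proof -
  have c: "c = \<beta> * \<beta> * \<beta> - a * \<beta> * \<beta> - b * \<beta>"
    using c_eq by (simp add: algebra_simps power2_eq_square)
  have "0 < (\<beta> - 1) * (1 - (a - \<beta>) + (\<beta>\<^sup>2 - a * \<beta> - b))"
    using conj_prod_pos[of 1] gt1 by simp
  also have "\<dots> = of_int (a + b + c - 1)" by (simp add: c algebra_simps power2_eq_square)
  finally show "1 < a + b + c" by simp
  have "0 < (\<beta> + 1) * (1 + (a - \<beta>) + (\<beta>\<^sup>2 - a * \<beta> - b))"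
    using conj_prod_pos[of "-1"] gt1 by simp
  also have "\<dots> = of_int (a + c + 1 - b)" by (simp add: c algebra_simps power2_eq_square)
  finally show "b < a + c + 1" by simp
qed

end

text \<open>By compactness of the circle two powers with widely spaced exponents are close; dividing
  by the smaller power gives a power close to 1.\<close>

lemma unit_power_recurrence:
  fixes u :: complex
  assumes "norm u = 1" "\<epsilon> > 0"
  shows "\<exists>k\<ge>k0. norm (u ^ k - 1) < \<epsilon>"
proof -
  have "\<forall>n. u ^ n \<in> sphere 0 1" using assms(1) by (simp add: norm_power)
  then obtain l s where s: "strict_mono (s :: nat \<Rightarrow> nat)" "((\<lambda>n. u ^ n) \<circ> s) \<longlonglongrightarrow> l"
    using compact_sphere[of "0 :: complex" 1] unfolding compact_def by meson
  have "Cauchy ((\<lambda>n. u ^ n) \<circ> s)" using s(2) by (rule LIMSEQ_imp_Cauchy)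
  then have "\<exists>M. \<forall>m\<ge>M. \<forall>n\<ge>M. norm (u ^ s m - u ^ s n) < \<epsilon>"
    using assms(2) unfolding Cauchy_def dist_norm o_def by blast
  then obtain M where M: "\<And>m n. m \<ge> M \<Longrightarrow> n \<ge> M \<Longrightarrow> norm (u ^ s m - u ^ s n) < \<epsilon>" by blast
  have ge: "s (M + i) \<ge> s M + i" for i
  proof (induction i)
    case (Suc i)
    then show ?case using strict_monoD[OF s(1), of "M + i" "M + Suc i"] by simp
  qed auto
  define k where "k = s (M + k0) - s M"
  have e: "s (M + k0) = s M + k" using ge[of k0] unfolding k_def by simp
  have "u ^ s (M + k0) - u ^ s M = u ^ s M * (u ^ k - 1)"
    unfolding e by (simp add: power_add algebra_simps)
  then have "norm (u ^ k - 1) = norm (u ^ s (M + k0) - u ^ s M)"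
    using assms(1) by (simp add: norm_mult norm_power)
  also have "\<dots> < \<epsilon>" by (rule M) auto
  finally have "norm (u ^ k - 1) < \<epsilon>" .
  moreover have "k \<ge> k0" using ge[of k0] unfolding k_def by simp
  ultimately show ?thesis by blast
qed

section \<open>Failure of property (F) with complex conjugates\<close>

locale cubic_pisot_complex = cubic_pisot1 +
  assumes b_le: "b \<le> - 2" and cnj: "\<alpha>2 = cnj \<alpha>1"
begin

text \<open>The value at 1 of \<open>X^2 + r1 X + r0\<close>, which equals
  \<open>(a + b) / (\<beta> - 1)\<close>. It is a fixed point of \<open>T\<close> with constant
  digit \<open>a + b\<close>.\<close>

definition x0 :: real where "x0 = 1 + r0 + r1"

lemma ab_ge: "1 \<le> a + b" using coeff_bounds c1 by simp

lemma r1_neg: "r1 < 0"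
proof -
  have "\<beta> * r1 < 0" unfolding beta_r1 using r0_range b_le by simp
  then show ?thesis using gt1 by (simp add: mult_less_0_iff)
qed

text \<open>The cubic is negative at \<open>a - 1\<close>, while its quadratic cofactor is
  nonnegative on the reals because its roots are complex conjugates; hence
  \<open>a - 1 < \<beta>\<close>.\<close>

lemma r1_gt: "- 1 < r1"
proof -
  define t :: real where "t = a - 1"
  have re: "2 * Re \<alpha>1 = a - \<beta>" using arg_cong[OF sum_conj, of Re] cnj by simp
  have im: "(Re \<alpha>1)\<^sup>2 + (Im \<alpha>1)\<^sup>2 = \<beta>\<^sup>2 - a * \<beta> - b"
    using arg_cong[OF prod_conj, of Re] cnj by (simp add: power2_eq_square)
  have "0 \<le> (t - Re \<alpha>1)\<^sup>2 + (Im \<alpha>1)\<^sup>2" by simp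
  also have "\<dots> = t\<^sup>2 - (2 * Re \<alpha>1) * t + ((Re \<alpha>1)\<^sup>2 + (Im \<alpha>1)\<^sup>2)"
    by (simp add: power2_eq_square algebra_simps)
  finally have q: "0 \<le> t\<^sup>2 - (a - \<beta>) * t + (\<beta>\<^sup>2 - a * \<beta> - b)" unfolding re im .
  have "(t - \<beta>) * (t\<^sup>2 - (a - \<beta>) * t + (\<beta>\<^sup>2 - a * \<beta> - b)) = t ^ 3 - a * t\<^sup>2 - b * t - (\<beta> ^ 3 - a * \<beta>\<^sup>2 - b * \<beta>)"
    by (simp add: power2_eq_square power3_eq_cube algebra_simps)
  also have "\<dots> = - of_int ((a - 1) * (a + b - 1)) - 1"
    unfolding cubic_eq c1 t_def by (simp add: power2_eq_square power3_eq_cube algebra_simps)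
  also have "\<dots> < 0"
  proof -
    have "0 \<le> (a - 1) * (a + b - 1)" using ab_ge b_le by simp
    then have "0 \<le> real_of_int ((a - 1) * (a + b - 1))" by (simp only: of_int_0_le_iff)
    then show ?thesis by linarith
  qed
  finally have "t < \<beta>" using q by (simp add: mult_less_0_iff)
  then show ?thesis by (simp add: r1_def t_def)
qed

lemma x0_mult: "(\<beta> - 1) * x0 = a + b"
proof -
  have "\<beta> * x0 = \<beta> + \<beta> * r0 + \<beta> * r1" by (simp add: x0_def algebra_simps)
  also have "\<dots> = a + b + x0" unfolding beta_r1 using gt1 by (simp add: x0_def r0_def r1_def)
  finally show ?thesis by (simp add: algebra_simps)
qed

lemma x0_lt_1: "x0 < 1"
proof -
  have "(\<beta> - 1) * x0 < (\<beta> - 1) * 1" unfolding x0_mult using r1_gt b_le by (simp add: r1_def)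
  then show ?thesis using gt1 by simp
qed

lemma x0_gt: "r0 < x0"
proof -
  have "(\<beta> - 1) * r0 = 1 - r0" using gt1 by (simp add: r0_def field_simps)
  also have "\<dots> < (\<beta> - 1) * x0" unfolding x0_mult using ab_ge r0_range by simp
  finally show ?thesis using gt1 by simp
qed

lemma x0_pos: "0 < x0" using x0_gt r0_range by linarith

definition multiples :: "real set" where
  "multiples = {x. \<exists>k :: int. x = k * x0 \<and> 0 \<le> x \<and> x < 1}"

lemma beta_mult_x0: "\<beta> * (k * x0) = k * (a + b) + k * x0" for k :: real
proof -
  have "\<beta> * x0 = a + b + x0" using x0_mult by (simp add: algebra_simps)
  then have "k * (\<beta> * x0) = k * (a + b + x0)" by simp
  then show ?thesis by (simp add: algebra_simps)
qed

lemma T_multiples: "x \<in> multiples \<Longrightarrow> T x = x"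
  unfolding multiples_def using beta_mult_x0
  by (auto intro!: T_unique[of _ "k * (a + b)" for k :: int])

text \<open>The counterpart of \<open>multiples\<close> for \<open>srs\<close>:
  \<open>phi (k, k)\<close> and \<open>k * x0\<close> differ by the integer
  \<open>k\<close>.\<close>

definition diag :: "(int \<times> int) set" where
  "diag = {v. \<exists>k. v = (k, k) \<and> 0 \<le> k * x0 \<and> k * x0 < 1}"

text \<open>Brunotte's argument with the absorbing set \<open>diag\<close> in place of the origin;
  each neighbour of a diagonal point is followed until it returns to the diagonal.\<close>

lemma srs_reaches_diag: "\<exists>n. (srs r0 r1 ^^ n) z \<in> diag"
proof -
  define P where "P v \<longleftrightarrow> (\<exists>n. (srs r0 r1 ^^ n) v \<in> diag)" for v
  have base: "P v" if "v \<in> diag" for v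
    unfolding P_def using that by (intro exI[of _ 0]) auto
  have step: "P (p, q)" if h: "P (q, k)" "0 \<le> r0 * p + r1 * q + k" "r0 * p + r1 * q + k < 1" for p q k
  proof -
    obtain n where "(srs r0 r1 ^^ n) (q, k) \<in> diag" using h(1) unfolding P_def by blast
    then have "(srs r0 r1 ^^ Suc n) (p, q) \<in> diag"
      unfolding funpow_Suc_right o_apply srs_eqI[OF h(2,3)] .
    then show ?thesis unfolding P_def by blast
  qed
  note bounds = r0_range r1_neg r1_gt x0_lt_1 x0_gt
  have r1: "r1 = x0 - r0 - 1" by (simp add: x0_def)
  let ?V = "{(0,0), (1,0), (-1,0), (0,1), (0,-1), (1,1), (-1,-1)} :: (int \<times> int) set"
  have V: "srs r0 r1 v \<in> ?V" if "v \<in> ?V" for v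
  proof -
    have "srs r0 r1 (0,0) = (0,0)" "srs r0 r1 (1,0) = (0,0)" "srs r0 r1 (-1,0) = (0,1)"
      "srs r0 r1 (0,1) = (1,1)" "srs r0 r1 (0,-1) = (-1,0)" "srs r0 r1 (1,1) = (1,1)"
      "srs r0 r1 (-1,-1) = (-1,0)"
      using bounds by (auto intro!: srs_eqI simp: r1)
    then show ?thesis using that by auto
  qed
  have "P (v + w)" if vw: "v \<in> diag" "w \<in> ?V" for v w
  proof -
    obtain k where v: "v = (k, k)" and k: "0 \<le> k * x0" "k * x0 < 1" using vw(1) unfolding diag_def by blast
    have D: "P (j, j)" if "0 \<le> j * x0" "j * x0 < 1" for j :: int
      using that by (intro base) (auto simp: diag_def)
    have "0 \<le> k" using k(1) x0_pos by (simp add: zero_le_mult_iff)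
    have kk: "P (k, k)" using k by (rule D)
    show ?thesis
    proof (cases "k = 0")
      case True
      have 00: "P (0, 0)" using D[of 0] by simp
      have 11: "P (1, 1)" using D[of 1] bounds by simp
      have 01: "P (0, 1)" using bounds by (intro step[OF 11]) (auto simp: r1)
      have n0: "P (-1, 0)" using bounds by (intro step[OF 01]) auto
      have "P (1, 0)" using bounds by (intro step[OF 00]) auto
      moreover have "P (0, -1)" using bounds by (intro step[OF n0]) (auto simp: r1)
      moreover have "P (-1, -1)" using bounds by (intro step[OF n0]) (auto simp: r1)
      ultimately show ?thesis using vw(2) v True 00 11 01 n0 by auto
    next
      case False
      then have "1 \<le> k" using \<open>0 \<le> k\<close> by simp
      then have "1 * x0 \<le> k * x0" using x0_pos by (intro mult_right_mono) auto
      moreover define X where "X = k * x0"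
      ultimately have X: "0 \<le> X" "X < 1" "r0 < X" "x0 \<le> X" using x0_gt k by auto
      \<comment> \<open>Expresses the argument of the floor near \<open>(k, k)\<close> through
        \<open>X\<close>. The case distinctions below decide whether it leaves [0,1); each case
        leads to a neighbour treated before.\<close>
      have e: "r0 * of_int (k + i) + r1 * of_int (k + j) + of_int l = X + r0 * i + r1 * j + (l - k)" for i j l
        by (simp add: r1 X_def algebra_simps)
      have m: "P (k - 1, k - 1)" using X x0_pos by (intro D) (auto simp: X_def algebra_simps)
      have n0: "P (k + -1, k + 0)" by (rule step[of _ k]; (unfold e)?) (use X bounds kk in auto)
      have 0: "P (k + 0, k + -1)"
      proof (cases "X - r1 < 1")
        case True
        show ?thesis by (rule step[of _ k]; (unfold e)?) (use X bounds True n0 in auto)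
      next
        case False
        show ?thesis by (rule step[of _ "k - 1"]; (unfold e)?) (use X bounds False m in auto)
      qed
      have 1: "P (k + 1, k + 0)"
      proof (cases "X + r0 < 1")
        case True
        show ?thesis by (rule step[of _ k]; (unfold e)?) (use X bounds True kk in auto)
      next
        case False
        show ?thesis by (rule step[of _ "k - 1"]; (unfold e)?) (use X bounds False 0 in auto)
      qed
      have 11: "P (k + 1, k + 1)"
      proof (cases "X + x0 < 1")
        case True
        then show ?thesis using X x0_pos by (intro D) (auto simp: X_def algebra_simps)
      next
        case False
        show ?thesis by (rule step[of _ k]; (unfold e)?) (use X bounds False 1 in \<open>auto simp: r1\<close>)
      qed
      have 01: "P (k + 0, k + 1)"
      proof (cases "X + r1 < 0")
        case True
        show ?thesis by (rule step[of _ "k + 1"]; (unfold e)?) (use X bounds True 11 in auto)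
      next
        case False
        show ?thesis by (rule step[of _ k]; (unfold e)?) (use X bounds False 1 in auto)
      qed
      show ?thesis using vw(2) v kk m n0 0 1 11 01 by auto
    qed
  qed
  then have K: "\<exists>n. (srs r0 r1 ^^ n) (v + w) \<in> diag" if "v \<in> diag" "w \<in> ?V" for v w
    using that unfolding P_def by blast
  show ?thesis
  proof (rule brunotte[where V = ?V])
    show "(0, 0) \<in> diag" by (auto simp: diag_def)
    show "- v \<in> ?V" if "v \<in> ?V" for v using that by auto
  qed (fact V K | simp)+
qed

lemma T_reaches_multiples:
  assumes "Zel x y z" "0 \<le> x" "x < 1"
  shows "\<exists>n. (T ^^ n) x \<in> multiples"
proof -
  obtain v where v: "x = frac (phi v)" using Zel_frac_phi[OF assms] by blast
  obtain n where "(srs r0 r1 ^^ n) v \<in> diag" using srs_reaches_diag by blast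
  then obtain k :: int where k: "(srs r0 r1 ^^ n) v = (k, k)" "0 \<le> k * x0" "k * x0 < 1"
    unfolding diag_def by blast
  have "phi (k, k) = k * x0 + of_int (- k)" by (simp add: phi_def x0_def algebra_simps)
  then have "frac (phi (k, k)) = frac (k * x0)" by (simp only: frac_add_of_int_right)
  also have "\<dots> = k * x0" using k by (simp add: frac_eq)
  finally have "(T ^^ n) x = k * x0" unfolding v T_funpow_frac_phi k(1) .
  then have "(T ^^ n) x \<in> multiples" using k unfolding multiples_def by auto
  then show ?thesis ..
qed

text \<open>Subtracting \<open>r0 = 1 / \<beta>\<close> lowers the next digit by one and leaves the
  tail unchanged.\<close>

lemma T_multiple_minus_r0:
  fixes k :: int
  assumes "1 \<le> k" "k * x0 < 1"
  shows "r0 < k * x0" "T (k * x0 - r0) = k * x0"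
proof -
  have "1 * x0 \<le> k * x0" using x0_pos assms by (intro mult_right_mono) auto
  then show "r0 < k * x0" using x0_gt by simp
  have "\<beta> * (k * x0 - r0) = of_int (k * (a + b) - 1) + k * x0"
    unfolding right_diff_distrib beta_mult_x0 using gt1 by (simp add: r0_def algebra_simps)
  then show "T (k * x0 - r0) = k * x0"
    using assms x0_pos by (intro T_unique[of _ "k * (a + b) - 1"]) auto
qed

text \<open>The orbit is explicit: the digits \<open>a - 1\<close> and \<open>a + b - 1\<close> lead
  to \<open>x0 - r0 ^ (l + 1)\<close>, which follows the fixed point \<open>x0\<close> without a
  borrow until \<open>x0 - r0\<close> is reached.\<close>

lemma T_one_minus: "(T ^^ (l + 3)) (1 - r0 ^ (l + 3)) = x0"
proof -
  have br: "\<beta> * r0 ^ Suc i = r0 ^ i" for i using gt1 by (simp add: r0_def)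
  have le: "r0 ^ Suc i \<le> r0" for i
    using r0_range power_le_one[of r0 i] by (simp add: mult_left_le)
  have b1: "\<beta> * (1 + r1) = of_int (a + b - 1) + x0"
    unfolding distrib_left beta_r1 by (simp add: x0_def r1_def)
  have ge: "r0 * r0 < 1 + r1"
  proof -
    have "r0 < \<beta> * (1 + r1)" unfolding b1 using ab_ge x0_gt by simp
    then have "r0 * r0 < r0 * (\<beta> * (1 + r1))" using r0_range by (intro mult_strict_left_mono)
    also have "\<dots> = 1 + r1" using gt1 by (simp add: r0_def)
    finally show ?thesis .
  qed
  have le2: "r0 ^ (l + 2) \<le> r0 * r0"
    using r0_range power_le_one[of r0 l] by (simp add: power_add power2_eq_square mult_left_le_one_le)
  have 1: "T (1 - r0 ^ (l + 3)) = 1 + r1 - r0 ^ (l + 2)"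
  proof (rule T_unique[of _ "a - 1"])
    have "\<beta> * (1 - r0 ^ (l + 3)) = \<beta> - r0 ^ (l + 2)"
      using br[of "l + 2"] by (simp add: right_diff_distrib numeral_3_eq_3)
    then show "\<beta> * (1 - r0 ^ (l + 3)) = of_int (a - 1) + (1 + r1 - r0 ^ (l + 2))"
      by (simp add: r1_def)
    show "0 \<le> 1 + r1 - r0 ^ (l + 2)" using ge le2 by linarith
    show "1 + r1 - r0 ^ (l + 2) < 1" using r1_neg zero_less_power[OF r0_range(1), of "l + 2"] by linarith
  qed
  have 2: "T (1 + r1 - r0 ^ (l + 2)) = x0 - r0 ^ (l + 1)"
  proof (rule T_unique[of _ "a + b - 1"])
    show "\<beta> * (1 + r1 - r0 ^ (l + 2)) = of_int (a + b - 1) + (x0 - r0 ^ (l + 1))"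
      unfolding right_diff_distrib b1 using br[of "l + 1"] by simp
    show "0 \<le> x0 - r0 ^ (l + 1)" using le[of l] x0_gt by simp
    show "x0 - r0 ^ (l + 1) < 1" using x0_lt_1 zero_less_power[OF r0_range(1), of "l + 1"] by linarith
  qed
  have xm: "x0 \<in> multiples"
    unfolding multiples_def using x0_pos x0_lt_1 by (auto intro!: exI[of _ "1 :: int"])
  have fx: "(T ^^ l) x0 = x0" using T_funpow_fixed T_multiples xm by blast
  have 3: "(T ^^ l) (x0 - r0 ^ (l + 1)) = x0 - r0"
    using le[of l] x0_gt x0_pos x0_lt_1 r0_range T_funpow_sub[of r0 l x0 "x0 - r0 ^ (l + 1)"]
    unfolding fx by (simp add: r0_def power_divide)
  have 4: "T (x0 - r0) = x0" using T_multiple_minus_r0(2)[of 1] x0_lt_1 by simp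
  have "(T ^^ (l + 3)) (1 - r0 ^ (l + 3)) = (T ^^ (Suc l)) (T (T (1 - r0 ^ (l + 3))))"
    by (simp only: numeral_3_eq_3 add_Suc_right add_0_right funpow_Suc_right o_apply)
  also have "\<dots> = x0" unfolding 1 2 using 3 4 by simp
  finally show ?thesis .
qed

text \<open>Subtracting \<open>1/\<beta>\<close> from an element with tiny conjugate either leaves a nonzero multiple
  of \<open>x0\<close> as tail, or the borrow produces \<open>1 - r0 ^ j\<close>, whose orbit ends in \<open>x0\<close>.\<close>

lemma infinite_expansion_near:
  obtains \<delta> where "\<delta> > 0"
    "\<And>m y z N n. Zel m y z \<Longrightarrow> 0 < m \<Longrightarrow> norm (y + 1 / \<alpha>1) < \<delta> \<Longrightarrow> m < \<beta> ^ N \<Longrightarrow> (T ^^ n) (m / \<beta> ^ N) \<noteq> 0"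
proof -
  \<comment> \<open>The slack of two places, together with the place of the last nonzero digit,
    supplies the \<open>l + 3\<close> steps of \<open>T_one_minus\<close>.\<close>
  obtain \<delta> N0 where \<delta>: "\<delta> > 0" "2 \<le> N0" and pre: "\<And>m y z N. Zel m y z \<Longrightarrow> 0 \<le> m \<Longrightarrow>
      norm y < \<delta> \<Longrightarrow> norm z < \<delta> \<Longrightarrow> m < \<beta> ^ N \<Longrightarrow> N0 \<le> N \<Longrightarrow> (T ^^ (N - 2)) (m / \<beta> ^ N) \<in> multiples"
    using uniform_preperiod[of multiples 2] T_multiples T_reaches_multiples by blast
  show thesis
  proof (rule that[OF \<delta>(1)], rule notI)
    fix m y z N n
    assume m: "Zel m y z" "0 < m" "norm (y + 1 / \<alpha>1) < \<delta>" "m < \<beta> ^ N" and fin: "(T ^^ n) (m / \<beta> ^ N) = 0"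
    \<comment> \<open>Adding \<open>1 / \<beta>\<close> makes the conjugates tiny, so the orbit of
      \<open>d\<close> is known.\<close>
    define d where "d = m + r0"
    have Zd: "Zel d (y + 1 / \<alpha>1) (z + 1 / \<alpha>2)"
      unfolding d_def r0_def by (intro Zel_add m(1) Zel_div_beta Zel_1)
    have "norm (z + 1 / \<alpha>2) = norm (y + 1 / \<alpha>1)"
      unfolding Zel_cnj[OF cnj Zd] by (rule complex_mod_cnj)
    then have dz: "norm (z + 1 / \<alpha>2) < \<delta>" using m(3) by simp
    obtain N1 where N1: "\<And>N. N \<ge> N1 \<Longrightarrow> d < \<beta> ^ N" using eventually_below_power by blast
    \<comment> \<open>Prepends \<open>j\<close> leading zeros, so that
      \<open>uniform_preperiod\<close> applies to \<open>d\<close>.\<close>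
    define j where "j = N0 + N1"
    define M where "M = N + j"
    have M: "N0 \<le> M" "d < \<beta> ^ M" using N1 by (auto simp: M_def j_def)
    define y0 where "y0 = d / \<beta> ^ M"
    define y1 where "y1 = m / \<beta> ^ M"
    have pM: "\<beta> ^ M > 0" using gt1 by simp
    have y0: "0 < y0" "y0 < 1" using M m(2) r0_range pM by (auto simp: y0_def d_def)
    have y1: "0 \<le> y1" "y1 = y0 - r0 / \<beta> ^ M"
      using m(2) pM by (auto simp: y0_def y1_def d_def diff_divide_distrib add_divide_distrib)
    have "(T ^^ (n + j)) y1 = 0"
    proof -
      have pN: "\<beta> ^ N > 0" using gt1 by simp
      have "(T ^^ j) (m / \<beta> ^ N / \<beta> ^ j) = m / \<beta> ^ N"
        using m pN by (intro T_funpow_div) auto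
      then show ?thesis using fin by (simp add: T_funpow_add y1_def M_def power_add)
    qed
    \<comment> \<open>A finite expansion cannot have a nonzero fixed point on its orbit.\<close>
    then have no: False if "(T ^^ i) y1 = f" "T f = f" "f \<noteq> 0" for i f
      using T_funpow_stays_0[of "n + j" y1 "n + j + i"] T_funpow_add[of "n + j" i y1]
        T_funpow_fixed[OF that(2), of "n + j"] that by simp
    have xm: "x0 \<in> multiples"
      unfolding multiples_def using x0_pos x0_lt_1 by (auto intro!: exI[of _ "1 :: int"])
    have mult: "(T ^^ (M - 2)) y0 \<in> multiples"
      unfolding y0_def using pre[OF Zd _ m(3) dz M(2,1)] m(2) r0_range by (simp add: d_def)
    then obtain k :: int where k: "(T ^^ (M - 2)) y0 = k * x0" "0 \<le> k * x0" "k * x0 < 1"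
      by (auto simp: multiples_def)
    have "0 \<le> k" using k(2) x0_pos by (simp add: zero_le_mult_iff)
    then consider "1 \<le> k" | "k = 0" by linarith
    then show False
    proof cases
      case 1
      have "M = 2 + (M - 2)" using M(1) \<delta>(2) by simp
      then have "(T ^^ M) y0 = (T ^^ 2) ((T ^^ (M - 2)) y0)" using T_funpow_add by metis
      also have "\<dots> = k * x0" unfolding k(1) using mult k(1) T_multiples T_funpow_fixed by metis
      finally have Tk: "(T ^^ M) y0 = k * x0" .
      then have "(T ^^ M) y1 = k * x0 - r0"
        using T_funpow_sub[OF _ _ _ _ y1] r0_range T_multiple_minus_r0(1)[OF 1 k(3)] y0 by simp
      then have "(T ^^ Suc M) y1 = k * x0" using T_multiple_minus_r0(2)[OF 1 k(3)] by simp
      then show False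
        by (rule no) (use T_multiples[of "k * x0"] mult k(1) 1 x0_pos in auto)
    next
      case 2
      define i where "i = (LEAST i. (T ^^ i) y0 = 0)"
      have T0: "(T ^^ (M - 2)) y0 = 0" using k(1) 2 by simp
      then have i: "(T ^^ i) y0 = 0" "i \<le> M - 2"
        unfolding i_def by (rule LeastI, rule Least_le)
      have "i \<noteq> 0" using i(1) y0 by (metis funpow_0 less_irrefl)
      then obtain i' where i': "i = Suc i'" using not0_implies_Suc by blast
      have "(T ^^ i') y0 \<noteq> 0" using not_less_Least[of i' "\<lambda>i. (T ^^ i) y0 = 0"] i' unfolding i_def by simp
      then have pos: "0 < (T ^^ i') y0" using T_funpow_range[of y0 i'] y0 by simp
      \<comment> \<open>The last nonzero digit of \<open>y0\<close>. The borrow lowers it to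
        \<open>w - 1\<close> and leaves the tail \<open>1 - r0 ^ (l + 3)\<close>.\<close>
      define w where "w = digit y0 i'"
      have w: "\<beta> * (T ^^ i') y0 = w" using i(1) unfolding i' w_def by (simp add: T_eq)
      with pos gt1 have "0 < real_of_int w" by (metis mult_pos_pos less_trans zero_less_one)
      then have w1: "1 \<le> w" by simp
      obtain l where l: "M = i' + (l + 3)"
      proof (rule that)
        show "M = i' + ((M - i' - 3) + 3)" using i(2) i' M(1) \<delta>(2) by simp
      qed
      have br: "\<beta> * r0 ^ Suc e = r0 ^ e" for e using gt1 by (simp add: r0_def)
      have "(T ^^ i') y0 = w * r0" using w gt1 by (simp add: r0_def field_simps)
      moreover have "r0 ^ (l + 4) \<le> w * r0"
      proof -
        have "r0 ^ (l + 4) \<le> 1 * r0"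
          using r0_range power_le_one[of r0 "l + 3"] by (simp add: eval_nat_numeral mult_left_le)
        also have "\<dots> \<le> w * r0" using w1 r0_range by (intro mult_right_mono) auto
        finally show ?thesis .
      qed
      moreover have "r0 / \<beta> ^ M = r0 ^ (l + 4) / \<beta> ^ i'"
        unfolding l by (simp add: r0_def power_add power_divide eval_nat_numeral)
      then have "y1 = y0 - r0 ^ (l + 4) / \<beta> ^ i'" unfolding y1(2) by simp
      ultimately have "(T ^^ i') y1 = (T ^^ i') y0 - r0 ^ (l + 4)"
        using y0 y1(1) r0_range by (intro T_funpow_sub) auto
      then have "\<beta> * (T ^^ i') y1 = w - r0 ^ (l + 3)"
        using w br[of "l + 3"] by (simp add: right_diff_distrib eval_nat_numeral)
      moreover have "0 < r0 ^ (l + 3)" "r0 ^ (l + 3) \<le> 1" using r0_range by (auto simp: power_le_one)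
      ultimately have "T ((T ^^ i') y1) = 1 - r0 ^ (l + 3)"
        by (intro T_unique[of _ "w - 1"]) auto
      then have "(T ^^ ((l + 3) + Suc i')) y1 = x0"
        using T_one_minus[of l] by (simp only: T_funpow_add funpow.simps o_apply)
      then show False by (rule no) (use T_multiples[OF xm] x0_pos in auto)
    qed
  qed
qed

text \<open>For a rational \<open>r\<close> close to \<open>\<alpha>1 ^ k\<close> with period
  \<open>n\<close>, the element \<open>(\<beta> ^ n - 1) * r / \<beta> ^ Suc k\<close> has finite
  expansion, while its conjugate is close to \<open>- 1 / \<alpha>1\<close>.\<close>

lemma gamma_not_pos: "\<not> gamma \<beta> > 0"
proof
  assume "gamma \<beta> > 0"
  then obtain c0 where c0: "c0 > 0" "c0 < 1"
    "\<And>x. x \<in> \<rat> \<Longrightarrow> 0 \<le> x \<Longrightarrow> x \<le> c0 \<Longrightarrow> \<exists>p>0. (T ^^ p) x = x"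
    unfolding gamma_pos_iff by blast
  obtain \<delta> where \<delta>: "\<delta> > 0" and inf: "\<And>m y z N n. Zel m y z \<Longrightarrow> 0 < m \<Longrightarrow>
      norm (y + 1 / \<alpha>1) < \<delta> \<Longrightarrow> m < \<beta> ^ N \<Longrightarrow> (T ^^ n) (m / \<beta> ^ N) \<noteq> 0"
    by (rule infinite_expansion_near) blast
  define \<rho> where "\<rho> = norm \<alpha>1"
  have \<rho>: "0 < \<rho>" "\<rho> < 1" using conj_nz conj_lt_1 by (auto simp: \<rho>_def)
  define u where "u = \<alpha>1 / of_real \<rho>"
  have u: "norm u = 1" "\<alpha>1 = of_real \<rho> * u" using \<rho> by (auto simp: u_def \<rho>_def norm_divide)
  obtain k0 where k0: "\<rho> ^ k0 < c0" using real_arch_pow_inv[OF c0(1) \<rho>(2)] by blast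
  obtain k where k: "k \<ge> k0" "norm (u ^ k - 1) < \<delta> * \<rho> / 2"
    using unit_power_recurrence[OF u(1), of "\<delta> * \<rho> / 2" k0] \<delta> \<rho> by auto
  have kc: "\<rho> ^ k < c0" using power_decreasing[OF k(1), of \<rho>] \<rho> k0 by linarith
  have "max 0 (\<rho> ^ k - \<delta> * \<rho> ^ Suc k / 2) < \<rho> ^ k" using \<delta> \<rho> by simp
  then obtain r where r: "r \<in> \<rat>" "max 0 (\<rho> ^ k - \<delta> * \<rho> ^ Suc k / 2) < r" "r < \<rho> ^ k"
    using Rats_dense_in_real by blast
  have r01: "0 \<le> r" "0 < r" "r \<le> c0" "r < 1" using r kc c0 by auto
  obtain p where p: "p > 0" "(T ^^ p) r = r" using c0(3) r(1) r01 by blast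
  \<comment> \<open>The room left for the term with \<open>\<alpha>1 ^ n\<close>, which becomes
    small for large \<open>n\<close>.\<close>
  define \<eta> where "\<eta> = \<delta> - norm (1 / \<alpha>1 - r / \<alpha>1 ^ Suc k)"
  have "norm (\<alpha>1 ^ k - of_real r) < \<delta> * \<rho> ^ Suc k"
  proof -
    have "\<alpha>1 ^ k - of_real r = of_real (\<rho> ^ k) * (u ^ k - 1) + of_real (\<rho> ^ k - r)"
      unfolding u(2) by (simp add: power_mult_distrib algebra_simps)
    also have "norm \<dots> \<le> norm (of_real (\<rho> ^ k) * (u ^ k - 1)) + norm (complex_of_real (\<rho> ^ k - r))"
      by (rule norm_triangle_ineq)
    also have "norm (of_real (\<rho> ^ k) * (u ^ k - 1)) = \<rho> ^ k * norm (u ^ k - 1)"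
      using \<rho> by (simp add: norm_mult norm_power)
    also have "norm (complex_of_real (\<rho> ^ k - r)) = \<rho> ^ k - r"
      unfolding norm_of_real using r by simp
    also have "\<rho> ^ k * norm (u ^ k - 1) \<le> \<rho> ^ k * (\<delta> * \<rho> / 2)"
      using k(2) \<rho> by (intro mult_left_mono) auto
    finally have "norm (\<alpha>1 ^ k - of_real r) \<le> \<rho> ^ k * (\<delta> * \<rho> / 2) + (\<rho> ^ k - r)" by simp
    moreover have "\<rho> ^ k - r < \<delta> * \<rho> ^ Suc k / 2" using r by simp
    moreover have "\<rho> ^ k * (\<delta> * \<rho> / 2) = \<delta> * \<rho> ^ Suc k / 2" by simp
    ultimately show ?thesis by linarith
  qed
  moreover have "1 / \<alpha>1 - r / \<alpha>1 ^ Suc k = (\<alpha>1 ^ k - of_real r) / \<alpha>1 ^ Suc k"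
    using conj_nz by (simp add: field_simps)
  ultimately have \<eta>: "\<eta> > 0"
    unfolding \<eta>_def using \<rho> by (simp add: norm_divide norm_power norm_mult \<rho>_def[symmetric] divide_less_eq)
  have "\<eta> * \<rho> ^ Suc k > 0" using \<eta> \<rho> by simp
  then obtain n0 where n0: "\<rho> ^ n0 < \<eta> * \<rho> ^ Suc k" using real_arch_pow_inv[OF _ \<rho>(2)] by blast
  define n where "n = p * (n0 + Suc k)"
  have "1 * (n0 + Suc k) \<le> n" unfolding n_def using p(1) by (intro mult_right_mono) auto
  then have n: "n0 \<le> n" "Suc k \<le> n" by auto
  have per: "(T ^^ n) r = r" unfolding n_def by (rule T_funpow_mult_period[OF p(2)])
  define m where "m = digit_sum \<beta> r n"
  have m: "m = (\<beta> ^ n - 1) * r" using power_eq_digit_sum[of n r] per by (simp add: m_def algebra_simps)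
  have Zm: "Zel m (digit_sum \<alpha>1 r n) (digit_sum \<alpha>2 r n)" unfolding m_def by (rule Zel_digit_sum)
  have y: "digit_sum \<alpha>1 r n = of_real r * (\<alpha>1 ^ n - 1)"
    using r(1) r01(1) per by (rule digit_sum_periodic(1))
  have "1 < \<beta> ^ n" using gt1 n by (intro one_less_power) auto
  then have m0: "0 < m" "m < \<beta> ^ n"
  proof -
    show "0 < m" unfolding m using \<open>1 < \<beta> ^ n\<close> r01 by simp
    have "m \<le> (\<beta> ^ n - 1) * 1" unfolding m using \<open>1 < \<beta> ^ n\<close> r01 by (intro mult_left_mono) auto
    then show "m < \<beta> ^ n" by simp
  qed
  have e: "\<beta> ^ n = \<beta> ^ Suc k * \<beta> ^ (n - Suc k)"
    unfolding power_add[symmetric] using n by simp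
  \<comment> \<open>\<open>m / \<beta> ^ n\<close> is \<open>r - r / \<beta> ^ n\<close>: the
    expansion of \<open>r\<close> cut off after \<open>n\<close> digits.\<close>
  have "(T ^^ n) (m / \<beta> ^ n) = (T ^^ n) r - r"
    using r01 m0 per gt1 by (intro T_funpow_sub) (auto simp: m field_simps)
  then have "(T ^^ n) (m / \<beta> ^ Suc k / \<beta> ^ (n - Suc k)) = 0"
    unfolding e per by simp
  moreover have "(T ^^ n) (m / \<beta> ^ Suc k / \<beta> ^ (n - Suc k)) \<noteq> 0"
  proof (rule inf)
    show "Zel (m / \<beta> ^ Suc k) (digit_sum \<alpha>1 r n / \<alpha>1 ^ Suc k) (digit_sum \<alpha>2 r n / \<alpha>2 ^ Suc k)"
      by (rule Zel_div_power[OF Zm])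
    show "0 < m / \<beta> ^ Suc k" using m0 gt1 by simp
    show "m / \<beta> ^ Suc k < \<beta> ^ (n - Suc k)" using m0(2) gt1 unfolding e by (simp add: divide_less_eq mult.commute)
    have "digit_sum \<alpha>1 r n / \<alpha>1 ^ Suc k + 1 / \<alpha>1 =
        (1 / \<alpha>1 - r / \<alpha>1 ^ Suc k) + of_real r * \<alpha>1 ^ n / \<alpha>1 ^ Suc k"
      unfolding y by (simp add: algebra_simps diff_divide_distrib)
    also have "norm \<dots> \<le> norm (1 / \<alpha>1 - r / \<alpha>1 ^ Suc k) + norm (of_real r * \<alpha>1 ^ n / \<alpha>1 ^ Suc k)"
      by (rule norm_triangle_ineq)
    also have "norm (of_real r * \<alpha>1 ^ n / \<alpha>1 ^ Suc k) < \<eta>"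
    proof -
      have "norm (of_real r * \<alpha>1 ^ n / \<alpha>1 ^ Suc k) = r * \<rho> ^ n / \<rho> ^ Suc k"
        using r01 by (simp add: norm_divide norm_mult norm_power \<rho>_def)
      also have "r * \<rho> ^ n \<le> 1 * \<rho> ^ n0"
        using r01 \<rho> n by (intro mult_mono power_decreasing) auto
      finally have "norm (of_real r * \<alpha>1 ^ n / \<alpha>1 ^ Suc k) \<le> \<rho> ^ n0 / \<rho> ^ Suc k"
        using \<rho> by (simp add: divide_right_mono)
      also have "\<dots> < \<eta>" using n0 \<rho> by (simp add: divide_less_eq)
      finally show ?thesis .
    qed
    finally show "norm (digit_sum \<alpha>1 r n / \<alpha>1 ^ Suc k + 1 / \<alpha>1) < \<delta>" by (simp add: \<eta>_def)
  qed
  ultimately show False by blast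
qed

end

section \<open>Necessity of the Pisot unit condition\<close>

lemma (in beta_map) digit_sum_div:
  assumes "0 \<le> x" "x < 1"
  shows "digit_sum z (x / \<beta> ^ n) n = 0"
proof (induction n)
  case (Suc n)
  have p: "1 \<le> \<beta> ^ n" using gt1 by (simp add: one_le_power)
  have r: "0 \<le> x / \<beta> ^ n" "x / \<beta> ^ n < 1" using assms p by (auto simp: divide_simps)
  have "\<beta> * (x / \<beta> ^ Suc n) = x / \<beta> ^ n" using gt1 by simp
  then have "T (x / \<beta> ^ Suc n) = x / \<beta> ^ n" "digit (x / \<beta> ^ Suc n) 0 = 0"
    using r by (auto intro!: T_unique[of _ 0] floor_unique)
  then show ?case using digit_sum_add[of z "x / \<beta> ^ Suc n" n 1] Suc by simp
qed simp

text \<open>The digits are \<open>k\<close> zeros, a one and \<open>N\<close> zeros;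
  \<open>w / \<beta> ^ N < \<beta> - 1\<close> keeps the tail before the digit one below 1.\<close>

lemma (in beta_map) digit_sum_power:
  assumes "0 \<le> w" "w < 1" "w / \<beta> ^ N < \<beta> - 1" "w / \<beta> ^ N < 1"
  shows "digit_sum z (1 / \<beta> ^ Suc k + w / \<beta> ^ (N + Suc k)) (N + Suc k) = z ^ N"
proof -
  define v where "v = w / \<beta> ^ N"
  define x where "x = (1 + v) / \<beta>"
  define r where "r = 1 / \<beta> ^ Suc k + w / \<beta> ^ (N + Suc k)"
  have v: "0 \<le> v" "v < 1" "v < \<beta> - 1" using assms gt1 by (auto simp: v_def)
  have x: "0 \<le> x" "x < 1" using v gt1 by (auto simp: x_def)
  have r: "r = x / \<beta> ^ k"
    using gt1 by (simp add: r_def x_def v_def add_divide_distrib power_add mult_ac)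
  have Tk: "(T ^^ k) r = x" unfolding r by (rule T_funpow_div[OF x])
  have bx: "\<beta> * x = 1 + v" using gt1 by (simp add: x_def)
  have "digit r k = 1" unfolding Tk bx using v by (intro floor_unique) auto
  moreover have "digit_sum z r k = 0" unfolding r by (rule digit_sum_div[OF x])
  ultimately have 1: "digit_sum z r (Suc k) = 1" by simp
  have "T x = v" using bx v by (intro T_unique[of _ 1]) auto
  then have "(T ^^ Suc k) r = v" using Tk by simp
  then have "digit_sum z r (N + Suc k) = z ^ N * 1 + digit_sum z v N"
    unfolding digit_sum_add 1 by simp
  also have "digit_sum z v N = 0" unfolding v_def using assms by (intro digit_sum_div) auto
  finally show ?thesis by (simp add: r_def)
qed

section \<open>Location of the conjugates\<close>

context cubic
begin

text \<open>At a positive \<open>t\<close> the digit sum is nonnegative, but its conjugate form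
  \<open>r * (t ^ p - 1)\<close> would be negative.\<close>

lemma conj_not_positive:
  assumes "r \<in> \<rat>" "0 < r" "r < 1" "(T ^^ p) r = r" "p > 0" "norm \<alpha>1 < 1" "\<alpha>1 = of_real t"
  shows "t \<le> 0"
proof (rule ccontr)
  assume "\<not> t \<le> 0"
  then have t: "0 < t" "t < 1" using assms(6,7) by auto
  have "complex_of_real (digit_sum t r p) = of_real (r * (t ^ p - 1))"
    using digit_sum_periodic(1)[OF assms(1) _ assms(4)] assms(2,7) by (simp add: digit_sum_of_real)
  then have "digit_sum t r p = r * (t ^ p - 1)" by (simp only: of_real_eq_iff)
  moreover have "0 \<le> digit_sum t r p" using assms t by (intro digit_sum_nonneg) auto
  moreover have "t ^ p < 1" using t assms(5) by (simp add: power_less_one_iff)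
  ultimately show False using assms(2) by (simp add: zero_le_mult_iff)
qed

text \<open>Schmidt's argument: if \<open>r = (\<Sum>n. d\<^sub>n \<beta>\<^sup>-\<^sup>n)\<close> is rational with periodic expansion, then
  \<open>r = (\<Sum>n. d\<^sub>n \<alpha>1\<^sup>-\<^sup>n)\<close>. Letting \<open>r\<close> tend to \<open>\<beta>\<^sup>-\<^sup>k\<close> from above yields
  \<open>\<beta>\<^sup>-\<^sup>k = \<alpha>1\<^sup>-\<^sup>k\<close>.\<close>

lemma expanding_conj_power:
  assumes per: "\<And>x. x \<in> \<rat> \<Longrightarrow> 0 \<le> x \<Longrightarrow> x \<le> c0 \<Longrightarrow> \<exists>p>0. (T ^^ p) x = x"
    and "1 / \<beta> ^ Suc k < c0" "c0 < 1" "norm \<alpha>1 > 1"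
  shows "\<alpha>1 ^ Suc k = of_real (\<beta> ^ Suc k)"
proof -
  let ?\<rho> = "norm \<alpha>1"
  define C where "C = 1 + \<beta> / (?\<rho> - 1)"
  define B where "B = complex_of_real (1 / \<beta> ^ Suc k)"
  define A where "A = 1 / \<alpha>1 ^ Suc k"
  have anz: "\<alpha>1 \<noteq> 0" using assms(4) by auto
  have bound: "norm (B - A) \<le> C * (1 / ?\<rho>) ^ N + (1 / \<beta>) ^ N" if "1 / \<beta> ^ N < \<beta> - 1" for N
  proof -
    define L where "L = N + Suc k"
    have pL: "\<beta> ^ L > 0" "\<beta> ^ N > 0" using gt1 by simp_all
    have "1 / \<beta> ^ Suc k < min (1 / \<beta> ^ Suc k + 1 / \<beta> ^ L) c0" using assms(2) pL by simp
    then obtain r where r: "r \<in> \<rat>" "1 / \<beta> ^ Suc k < r" "r < 1 / \<beta> ^ Suc k + 1 / \<beta> ^ L" "r < c0"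
      using Rats_dense_in_real by (metis min_less_iff_conj)
    have r0: "0 < r" using r(2) gt1 by (smt (verit) zero_less_divide_1_iff zero_less_power)
    obtain p where p: "p > 0" "(T ^^ p) r = r" using per[of r] r r0 by auto
    define w where "w = (r - 1 / \<beta> ^ Suc k) * \<beta> ^ L"
    have re: "r = 1 / \<beta> ^ Suc k + w / \<beta> ^ L" using gt1 by (simp add: w_def)
    have w: "0 \<le> w" "w < 1" using r pL by (simp_all add: w_def flip: pos_less_divide_eq)
    have "w / \<beta> ^ N \<le> 1 / \<beta> ^ N" using w pL by (intro divide_right_mono) auto
    moreover have "w / \<beta> ^ N < 1"
      using w gt1 one_le_power[of \<beta> N] pL by (simp add: divide_less_eq del: one_le_power)
    ultimately have ds: "digit_sum \<alpha>1 r L = \<alpha>1 ^ N"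
      unfolding re L_def using w that by (intro digit_sum_power) auto
    \<comment> \<open>\<open>M + L\<close> is a multiple of the period, and the factor
      \<open>L\<close> makes it at least \<open>L\<close>.\<close>
    define M where "M = p * L - L"
    have n: "M + L = p * L" using p(1) by (simp add: M_def)
    have "(T ^^ (M + L)) r = r" unfolding n by (rule T_funpow_mult_period[OF p(2)])
    then have "digit_sum \<alpha>1 r (M + L) = of_real r * (\<alpha>1 ^ (M + L) - 1)"
      using r r0 by (intro digit_sum_periodic(1)) auto
    \<comment> \<open>The first \<open>L\<close> digits contribute exactly
      \<open>\<alpha>1 ^ (M + N)\<close>. After division by \<open>\<alpha>1 ^ (M + L)\<close> this
      term is \<open>A\<close>, and the right-hand side is of order
      \<open>?\<rho> ^ (- L)\<close>.\<close>
    then have e: "of_real r * \<alpha>1 ^ (M + L) - \<alpha>1 ^ (M + N) = digit_sum \<alpha>1 ((T ^^ L) r) M + of_real r"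
      unfolding digit_sum_add ds by (simp add: power_add algebra_simps)
    have rg: "0 \<le> r" "r < 1" using r0 r assms(3) by auto
    have "norm (digit_sum \<alpha>1 ((T ^^ L) r) M + of_real r) \<le> \<beta> / (?\<rho> - 1) * ?\<rho> ^ M + 1"
      using norm_triangle_ineq[of "digit_sum \<alpha>1 ((T ^^ L) r) M" "of_real r"]
        norm_digit_sum_le_expanding[OF T_funpow_range[OF rg, of L] assms(4), of M] rg by simp
    also have "\<dots> \<le> C * ?\<rho> ^ M"
      using one_le_power[of ?\<rho> M] assms(4) by (simp add: C_def distrib_right)
    finally have le: "norm (of_real r * \<alpha>1 ^ (M + L) - \<alpha>1 ^ (M + N)) \<le> C * ?\<rho> ^ M" unfolding e .
    have "of_real r - A = (of_real r * \<alpha>1 ^ (M + L) - \<alpha>1 ^ (M + N)) / \<alpha>1 ^ (M + L)"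
      using anz by (simp add: A_def L_def diff_divide_distrib power_add)
    then have "norm (of_real r - A) \<le> C * ?\<rho> ^ M / ?\<rho> ^ (M + L)"
      using le by (simp add: norm_divide norm_power divide_right_mono)
    also have "\<dots> = C * (1 / ?\<rho>) ^ L" using anz by (simp add: power_add power_divide)
    also have "\<dots> \<le> C * (1 / ?\<rho>) ^ N"
      using assms(4) gt1 unfolding C_def L_def
      by (intro mult_left_mono power_decreasing) (auto simp: divide_le_eq_1)
    finally have 1: "norm (of_real r - A) \<le> C * (1 / ?\<rho>) ^ N" .
    have "norm (B - of_real r) = r - 1 / \<beta> ^ Suc k"
      unfolding B_def of_real_diff[symmetric] norm_of_real using r by simp
    also have "\<dots> \<le> (1 / \<beta>) ^ L" using r by (simp add: power_divide)
    also have "\<dots> \<le> (1 / \<beta>) ^ N" unfolding L_def using gt1 by (intro power_decreasing) auto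
    finally have "norm (B - of_real r) \<le> (1 / \<beta>) ^ N" .
    with 1 show ?thesis using norm_triangle_ineq[of "B - of_real r" "of_real r - A"] by simp
  qed
  obtain N0 where N0: "\<And>N. N \<ge> N0 \<Longrightarrow> 1 / (\<beta> - 1) < \<beta> ^ N" using eventually_below_power by blast
  have "norm (B - A) \<le> C * (1 / ?\<rho>) ^ N + (1 / \<beta>) ^ N" if "N \<ge> N0" for N
    using N0[OF that] gt1 by (intro bound) (simp add: field_simps)
  then have ev: "\<exists>N0. \<forall>N\<ge>N0. norm (B - A) \<le> C * (1 / ?\<rho>) ^ N + (1 / \<beta>) ^ N" by blast
  have "(\<lambda>N. C * (1 / ?\<rho>) ^ N + (1 / \<beta>) ^ N) \<longlonglongrightarrow> C * 0 + 0"
    using assms(4) gt1 by (intro tendsto_intros LIMSEQ_realpow_zero) (auto simp: divide_less_eq_1)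
  from LIMSEQ_le_const[OF this ev] have "B = A" by simp
  then show ?thesis using gt1 anz unfolding B_def A_def by (simp add: field_simps)
qed

text \<open>Equality of two consecutive powers of \<open>\<alpha>1\<close> and
  \<open>\<beta>\<close> would give \<open>\<alpha>1 = \<beta>\<close>.\<close>

lemma conj_norm_le_1:
  assumes "c0 > 0" "c0 < 1" "\<And>x. x \<in> \<rat> \<Longrightarrow> 0 \<le> x \<Longrightarrow> x \<le> c0 \<Longrightarrow> \<exists>p>0. (T ^^ p) x = x"
  shows "norm \<alpha>1 \<le> 1"
proof (rule ccontr)
  assume "\<not> norm \<alpha>1 \<le> 1"
  then have n: "norm \<alpha>1 > 1" by simp
  obtain k where k: "\<And>N. N \<ge> k \<Longrightarrow> 1 / c0 < \<beta> ^ N" using eventually_below_power by blast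
  have lt: "1 / \<beta> ^ N < c0" if "N \<ge> k" for N
    using k[OF that] assms(1) gt1 by (simp add: field_simps)
  have 1: "\<alpha>1 ^ Suc k = of_real (\<beta> ^ Suc k)" and 2: "\<alpha>1 ^ Suc (Suc k) = of_real (\<beta> ^ Suc (Suc k))"
    by (rule expanding_conj_power[OF assms(3) lt assms(2) n]; simp)+
  have "\<alpha>1 * of_real (\<beta> ^ Suc k) = of_real \<beta> * of_real (\<beta> ^ Suc k)"
    using 2 unfolding power_Suc[of _ "Suc k"] 1 by simp
  then have "\<alpha>1 = of_real \<beta>" using gt1 by (simp del: power_Suc)
  with conj_ne_beta show False by simp
qed

text \<open>A real conjugate 1 or -1, or a complex pair with product 1, would yield a monic
  quadratic relation for \<open>\<beta>\<close>.\<close>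

lemma conj_norm_ne_1: "norm \<alpha>1 \<noteq> 1"
proof
  assume n: "norm \<alpha>1 = 1"
  consider "\<alpha>1 \<in> \<real>" | "\<alpha>2 = cnj \<alpha>1" using conj_cases by blast
  then show False
  proof cases
    case 1
    then obtain t where t: "\<alpha>1 = of_real t" by (auto elim: Reals_cases)
    with n have "t \<in> {1, -1}" by auto
    then obtain e :: int where e: "e * e = 1" "t = of_int e" by (auto intro: that[of 1] that[of "-1"])
    have "complex_of_real (t\<^sup>2) = of_real ((a - \<beta>) * t - (\<beta>\<^sup>2 - a * \<beta> - b))"
      using conj_quadratic[of \<alpha>1] t by simp
    then have "t\<^sup>2 = (a - \<beta>) * t - (\<beta>\<^sup>2 - a * \<beta> - b)" by (simp only: of_real_eq_iff)
    then have "of_int (e * e - a * e - b) + of_int (e - a) * \<beta> + of_int 1 * \<beta>\<^sup>2 = 0"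
      unfolding e(2) by (simp add: power2_eq_square algebra_simps)
    from indep[OF this] show False by simp
  next
    case 2
    have "\<alpha>1 * \<alpha>2 = 1" unfolding 2 complex_norm_square[symmetric] n by simp
    then have "complex_of_real (\<beta>\<^sup>2 - a * \<beta> - b) = of_real 1" unfolding prod_conj by simp
    then have "\<beta>\<^sup>2 - a * \<beta> - b = 1" by (simp only: of_real_eq_iff)
    then have "of_int (- b - 1) + of_int (- a) * \<beta> + of_int 1 * \<beta>\<^sup>2 = 0" by (simp add: algebra_simps)
    from indep[OF this] show False by simp
  qed
qed

section \<open>Units and algebraic integrality\<close>

lemma mult_beta_coord:
  fixes u v w :: int
  shows "\<beta> * (of_int u + of_int v * \<beta> + of_int w * \<beta>\<^sup>2) =
    of_int (w * c) + of_int (u + w * b) * \<beta> + of_int (v + w * a) * \<beta>\<^sup>2"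
proof -
  have "\<beta> * (of_int u + of_int v * \<beta> + of_int w * \<beta>\<^sup>2) = of_int u * \<beta> + of_int v * \<beta>\<^sup>2 + of_int w * \<beta> ^ 3"
    by (simp add: algebra_simps power2_eq_square power3_eq_cube)
  then show ?thesis unfolding cubic_eq by (simp add: algebra_simps)
qed

text \<open>The constant coordinate of a multiple of \<open>\<beta>\<close> is divisible by
  \<open>c\<close>; comparing constant coordinates shows that \<open>c\<close> divides 1.\<close>

lemma unit_if_inverse:
  assumes "\<beta> * x - of_int c * x' = 1" "Zel x y z" "Zel x' y' z'"
  shows "\<bar>c\<bar> = 1"
proof -
  obtain u v w :: int where x: "x = of_int u + of_int v * \<beta> + of_int w * \<beta>\<^sup>2"
    using assms(2) unfolding Zel_def by blast
  obtain u' v' w' :: int where x': "x' = of_int u' + of_int v' * \<beta> + of_int w' * \<beta>\<^sup>2"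
    using assms(3) unfolding Zel_def by blast
  have "of_int (w * c - c * u' - 1) + of_int (u + w * b - c * v') * \<beta> + of_int (v + w * a - c * w') * \<beta>\<^sup>2 = 0"
    using assms(1) unfolding x x' mult_beta_coord by (simp add: algebra_simps)
  from indep[OF this] have "w * c - c * u' - 1 = 0" by blast
  then have "c * (w - u') = 1" by (simp add: algebra_simps)
  then show ?thesis using abs_zmult_eq_1[of c "w - u'"] by simp
qed

lemma Zel_poly: "\<exists>y z. Zel (poly (map_poly of_int P) \<beta>) y z"
proof (induction P)
  case (pCons k P)
  then obtain y z where "Zel (poly (map_poly of_int P) \<beta>) y z" by blast
  from Zel_add[OF Zel_of_int[of k] Zel_mult_beta[OF this]]
  show ?case by (auto simp: map_poly_pCons)
qed (auto intro: Zel_0)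

text \<open>Reversing a monic polynomial for \<open>1 / \<beta>\<close> gives one with constant
  coefficient 1 that vanishes at \<open>\<beta>\<close>, so 1 is \<open>\<beta>\<close> times a ring
  element.\<close>

lemma unit_if_algebraic_int_inverse:
  assumes "algebraic_int x" "\<beta> * x = 1"
  shows "\<bar>c\<bar> = 1"
proof -
  obtain g :: "int poly" where g: "poly (map_poly of_int g) x = 0" "lead_coeff g = 1"
    using assms(1) unfolding algebraic_int_altdef_ipoly by blast
  have x: "x = inverse \<beta>" using assms(2) gt1 by (simp add: field_simps)
  have "map_poly of_int (reflect_poly g) = reflect_poly (map_poly of_int g :: real poly)"
    by (rule poly_eqI) (simp add: coeff_map_poly coeff_reflect_poly degree_map_poly)
  then have "poly (map_poly of_int (reflect_poly g)) \<beta> = 0"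
    using g(1) gt1 x by (simp add: poly_reflect_poly_nz)
  moreover obtain Q where Q: "reflect_poly g = pCons 1 Q"
    using g(2) by (metis coeff_0_reflect_poly coeff_pCons_0 pCons_cases)
  ultimately have "1 + \<beta> * poly (map_poly of_int Q) \<beta> = 0" by (simp add: map_poly_pCons)
  moreover obtain y z where "Zel (poly (map_poly of_int Q) \<beta>) y z" using Zel_poly by blast
  ultimately show ?thesis
    by (intro unit_if_inverse[OF _ Zel_uminus Zel_0]) auto
qed

text \<open>Periodicity gives \<open>\<beta> ^ p = 1 + \<bar>c\<bar> * n * I\<close>, so
  \<open>\<beta>\<close> is invertible modulo \<open>c\<close>; the factor \<open>n\<close> makes
  the rational number as small as required.\<close>

lemma unit_if_periodic:
  fixes n :: nat
  assumes "c \<noteq> 0" "n > 0" "(T ^^ p) (1 / (\<bar>c\<bar> * n)) = 1 / (\<bar>c\<bar> * n)" "p > 0"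
  shows "\<bar>c\<bar> = 1"
proof -
  define r where "r = 1 / (\<bar>real_of_int c\<bar> * n)"
  define I where "I = digit_sum \<beta> r p"
  have "\<beta> ^ p * r = I + r" using power_eq_digit_sum[of p r] assms(3) by (simp add: I_def r_def)
  then have "\<beta> ^ p = \<bar>real_of_int c\<bar> * n * I + 1"
    using assms(1,2) by (simp add: r_def field_simps)
  also have "\<bar>real_of_int c\<bar> = of_int c * of_int (sgn c)"
    by (metis abs_sgn of_int_abs of_int_mult)
  finally have "\<beta> * \<beta> ^ (p - 1) - of_int c * (of_int (sgn c * int n) * I) = 1"
    using assms(4) by (simp flip: power_Suc add: algebra_simps)
  moreover have "Zel I (digit_sum \<alpha>1 r p) (digit_sum \<alpha>2 r p)" unfolding I_def by (rule Zel_digit_sum)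
  ultimately show ?thesis using unit_if_inverse Zel_power Zel_mult_int by blast
qed

end

text \<open>Periodicity reads \<open>\<beta> ^ p - n * P(\<beta>) - 1 = 0\<close> with
  \<open>P\<close> of degree below \<open>p\<close>, a monic integer equation.\<close>

lemma (in beta_map) algebraic_int_if_periodic:
  assumes "n > 0" "(T ^^ p) (1 / real n) = 1 / real n" "p > 0"
  shows "algebraic_int \<beta>"
proof -
  obtain P :: "int poly" where P: "degree P < Suc p" "coeff P p = 0"
    "\<And>z :: real. digit_sum z (1 / real n) p = poly (map_poly of_int P) z"
    using digit_sum_poly[of p "1 / real n"] by blast
  have "degree P \<noteq> p" using P(2) assms(3) by (metis degree_0 leading_coeff_0_iff not_gr_zero)
  then have dP: "degree P < p" using P(1) by simp
  define g :: "real poly" where "g = - smult (of_nat n) (map_poly of_int P) - 1"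
  have "degree (map_poly of_int P :: real poly) < p" by (simp add: degree_map_poly dP)
  then have "degree g < p" unfolding g_def using assms(3)
    by (intro degree_diff_less) (auto intro: le_less_trans[OF degree_smult_le])
  then have "lead_coeff (g + monom 1 p) = lead_coeff (monom (1 :: real) p)"
    by (intro lead_coeff_add_le) (simp add: degree_monom_eq)
  then have "lead_coeff (g + monom 1 p) = 1" by (simp only: lead_coeff_monom)
  moreover have "\<forall>i. coeff (g + monom 1 p) i \<in> \<int>"
    by (auto simp: g_def coeff_map_poly coeff_1)
  moreover have "poly (g + monom 1 p) \<beta> = 0"
    using power_eq_digit_sum[of p "1 / real n"] assms(1,2) P(3)[of \<beta>]
    by (simp add: g_def poly_monom field_simps)
  ultimately show ?thesis by (rule algebraic_int.intros)
qed

section \<open>Minimal polynomials\<close>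

text \<open>An annihilating polynomial of least degree divides all others, among them the
  irreducible \<open>min_poly x\<close>, with which it is therefore associated.\<close>

lemma min_poly_dvd:
  fixes x :: "'a :: field_char_0"
  assumes "algebraic x" "poly (map_poly of_rat q) x = 0"
  shows "min_poly x dvd q"
proof (cases "q = 0")
  case False
  define e where "e p = poly (map_poly of_rat p) x" for p
  have e_mod: "e (p mod m) = 0" if "e p = 0" "e m = 0" for p m
    using that poly_of_rat_add[of "p div m * m" "p mod m" x] by (simp add: e_def poly_of_rat_mult)
  have "q \<noteq> 0 \<and> e q = 0" using False assms(2) by (simp add: e_def)
  then obtain m where m: "m \<noteq> 0" "e m = 0"
    and least: "\<And>p. p \<noteq> 0 \<Longrightarrow> e p = 0 \<Longrightarrow> degree m \<le> degree p"
    using ex_has_least_nat[of "\<lambda>p. p \<noteq> 0 \<and> e p = 0" q degree] by metis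
  have dvd: "m dvd p" if "e p = 0" for p
  proof -
    have "p mod m = 0"
      using least[of "p mod m"] e_mod[OF that m(2)] degree_mod_less[OF m(1), of p] by linarith
    then show ?thesis by (simp add: dvd_eq_mod_eq_0)
  qed
  have "m dvd min_poly x" using min_poly_unique(3)[OF assms(1)] by (intro dvd) (simp add: e_def)
  then have "min_poly x dvd m \<or> is_unit m"
    using min_poly_unique(2)[OF assms(1)] by (rule irreducibleD'[rotated])
  moreover have "\<not> is_unit m"
    using m by (auto simp: is_unit_poly_iff e_def map_poly_pCons)
  moreover have "m dvd q" using assms(2) by (intro dvd) (simp add: e_def)
  ultimately show ?thesis by (blast intro: dvd_trans)
qed simp

section \<open>Gauss's lemma and the cubic minimal polynomial\<close>

lemma map_poly_of_int_mult:
  "map_poly of_int (p * q) = (map_poly of_int p * map_poly of_int q :: 'a :: {comm_ring_1, ring_char_0} poly)"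
  by (rule poly_eqI) (simp add: coeff_map_poly coeff_mult)

lemma map_poly_of_int_smult:
  "map_poly of_int (smult k p) = (smult (of_int k) (map_poly of_int p) :: 'a :: {comm_ring_1, ring_char_0} poly)"
  by (rule poly_eqI) (simp add: coeff_map_poly)

lemma map_poly_of_int_inject:
  "map_poly of_int p = (map_poly of_int q :: 'a :: {comm_ring_1, ring_char_0} poly) \<longleftrightarrow> p = q"
  by (auto simp: poly_eq_iff coeff_map_poly)

lemma clear_denominators:
  fixes p :: "rat poly"
  shows "\<exists>N>0. \<exists>P :: int poly. smult (of_int N) p = map_poly of_int P"
proof (induction p)
  case 0
  show ?case by (intro exI[of _ 1] conjI exI[of _ 0]) auto
next
  case (pCons x p)
  then obtain N P where N: "N > 0" "smult (of_int N) p = map_poly of_int P" by blast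
  obtain s t where "quotient_of x = (s, t)" by (cases "quotient_of x")
  then have st: "t > 0" "x = of_int s / of_int t"
    using quotient_of_denom_pos quotient_of_div by blast+
  have "smult (of_int (t * N)) (pCons x p) = map_poly of_int (pCons (s * N) (smult t P))"
    using st by (simp add: map_poly_pCons map_poly_of_int_smult flip: N(2))
  then show ?case using N(1) st(1) by (intro exI[of _ "t * N"]) auto
qed

text \<open>Gauss's lemma: after clearing denominators the contents multiply to
  \<open>N * M\<close>, and since the factors are monic each content divides its denominator. So
  each is its denominator up to sign, and \<open>P\<close> can be divided by
  \<open>N\<close>.\<close>

lemma monic_factor_of_monic_int_poly:
  fixes m g :: "rat poly" and f :: "int poly"
  assumes "lead_coeff f = 1" "map_poly of_int f = m * g" "lead_coeff m = 1"
  shows "\<exists>m'. m = map_poly of_int m'"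
proof -
  obtain N P where P: "N > 0" "smult (of_int N) m = map_poly of_int P" using clear_denominators by blast
  obtain M Q where Q: "M > 0" "smult (of_int M) g = map_poly of_int Q" using clear_denominators by blast
  have "lead_coeff (map_poly of_int f :: rat poly) = 1"
    using assms(1) by (simp add: coeff_map_poly degree_map_poly)
  then have lg: "lead_coeff g = 1" using assms(2,3) by (simp add: lead_coeff_mult)
  have "map_poly of_int (P * Q) = (map_poly of_int (smult (N * M) f) :: rat poly)"
    by (simp add: map_poly_of_int_mult map_poly_of_int_smult assms(2) mult.commute flip: P(2) Q(2))
  then have PQ: "P * Q = smult (N * M) f" by (simp only: map_poly_of_int_inject)
  have lead: "Polynomial.content R dvd K"
    if "smult (of_int K) h = map_poly of_int R" "lead_coeff h = 1" for R :: "int poly" and K and h :: "rat poly"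
  proof -
    have "(of_int (coeff R (degree h)) :: rat) = of_int K"
      using arg_cong[OF that(1), of "\<lambda>p. coeff p (degree h)"] that(2) by (simp add: coeff_map_poly)
    then show ?thesis by (metis content_dvd_coeff of_int_eq_iff)
  qed
  have "Polynomial.content f = 1" 
    using content_dvd_coeff[of f "degree f"] assms(1) by (metis is_unit_normalize normalize_content)
  then have "Polynomial.content P * Polynomial.content Q = N * M"
    using arg_cong[OF PQ, of Polynomial.content] P(1) Q(1) by (simp add: content_mult abs_mult)
  moreover obtain i j where ij: "N = Polynomial.content P * i" "M = Polynomial.content Q * j"
    using lead[OF P(2) assms(3)] lead[OF Q(2) lg] by (auto elim!: dvdE)
  ultimately have "Polynomial.content P * Polynomial.content Q * (i * j) = Polynomial.content P * Polynomial.content Q * 1" by (simp add: mult_ac)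
  moreover have "Polynomial.content P * Polynomial.content Q \<noteq> 0" using ij P(1) Q(1) by auto
  ultimately have "i * j = 1" by (metis mult_left_cancel)
  then have "\<bar>i\<bar> = 1" using abs_zmult_eq_1[of i j] by simp
  then have "i * i = 1" by (metis abs_mult_self_eq mult_1)
  then have "Polynomial.content P = N * i" using ij(1) by (simp add: mult.assoc)
  then have "smult (N * i) (primitive_part P) = P" by (metis content_times_primitive_part)
  then obtain R where R: "P = smult N R" by (metis smult_smult)
  have "smult (of_int N) m = smult (of_int N) (map_poly of_int R :: rat poly)"
    unfolding P(2) R map_poly_of_int_smult ..
  then have "m = map_poly of_int R" using P(1) by (simp add: smult_eq_iff)
  then show ?thesis ..
qed

lemma cubic_exists:
  assumes "\<beta> > 1" "algebraic_int \<beta>" "algebraic_degree \<beta> = 3"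
  obtains a b c \<alpha>1 \<alpha>2 where "cubic \<beta> a b c \<alpha>1 \<alpha>2" "galois_conjugates \<beta> = {of_real \<beta>, \<alpha>1, \<alpha>2}"
proof -
  have alg: "algebraic \<beta>" using assms(2) by (rule algebraic_int_imp_algebraic)
  note mp = min_poly_unique[OF alg]
  obtain f :: "int poly" where f: "poly (map_poly of_int f) \<beta> = 0" "lead_coeff f = 1"
    using assms(2) unfolding algebraic_int_altdef_ipoly by blast
  have "map_poly of_rat (map_poly of_int f :: rat poly) = (map_poly of_int f :: real poly)"
    by (intro poly_eqI) (simp add: coeff_map_poly)
  then have "min_poly \<beta> dvd map_poly of_int f" using f(1) by (intro min_poly_dvd[OF alg]) simp
  then obtain g where "map_poly of_int f = min_poly \<beta> * g" by (rule dvdE)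
  then obtain m where m: "min_poly \<beta> = map_poly of_int m"
    using monic_factor_of_monic_int_poly f(2) mp(1) by blast
  have deg: "degree m = 3" using assms(3) unfolding algebraic_degree_def m by (simp add: degree_map_poly)
  have lead: "coeff m 3 = 1" using mp(1) unfolding m by (simp add: degree_map_poly coeff_map_poly deg)
  define a where "a = - coeff m 2"
  define b where "b = - coeff m 1"
  define c where "c = - coeff m 0"
  have meq: "m = [:- c, - b, - a, 1:]"
  proof (rule poly_eqI)
    fix n :: nat
    consider "n = 0" | "n = 1" | "n = 2" | "n = 3" | "n > 3" by linarith
    then show "coeff m n = coeff [:- c, - b, - a, 1:] n"
    proof cases
      case 5
      then show ?thesis using coeff_eq_0[of m n] deg by (simp add: coeff_eq_0)
    qed (use lead in \<open>simp_all add: a_def b_def c_def numeral_2_eq_2 numeral_3_eq_3\<close>)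
  qed
  have mpeq: "poly (map_poly of_rat (min_poly \<beta>)) z = z ^ 3 - of_int a * z\<^sup>2 - of_int b * z - of_int c"
    for z :: "'b :: field_char_0"
    unfolding m meq
    by (simp add: map_poly_pCons of_rat_minus algebra_simps power2_eq_square power3_eq_cube)
  have ceq: "\<beta> ^ 3 = a * \<beta>\<^sup>2 + b * \<beta> + c" using mp(3) unfolding mpeq by simp
  define r1 where "r1 = \<beta> - a"
  define r0 where "r0 = \<beta>\<^sup>2 - a * \<beta> - b"
  \<comment> \<open>The square root of the discriminant of the quadratic cofactor; the quadratic
    formula provides both conjugates, real or complex.\<close>
  define D where "D = csqrt (of_real (r1\<^sup>2 - 4 * r0))"
  have D: "D\<^sup>2 = of_real (r1\<^sup>2 - 4 * r0)" by (simp add: D_def)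
  define \<alpha>1 where "\<alpha>1 = (- of_real r1 + D) / 2"
  define \<alpha>2 where "\<alpha>2 = (- of_real r1 - D) / 2"
  have sum: "\<alpha>1 + \<alpha>2 = of_real (a - \<beta>)" by (simp add: \<alpha>1_def \<alpha>2_def r1_def flip: add_divide_distrib)
  have "\<alpha>1 * \<alpha>2 = (of_real r1 ^ 2 - D\<^sup>2) / 4"
    by (simp add: \<alpha>1_def \<alpha>2_def power2_eq_square algebra_simps)
  also have "\<dots> = of_real r0" unfolding D by simp
  finally have prod: "\<alpha>1 * \<alpha>2 = of_real (\<beta>\<^sup>2 - a * \<beta> - b)" unfolding r0_def .
  have indep: "u = 0 \<and> v = 0 \<and> w = 0" if "of_int u + of_int v * \<beta> + of_int w * \<beta>\<^sup>2 = 0" for u v w :: int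
  proof -
    let ?q = "[:of_int u, of_int v, of_int w:] :: rat poly"
    have "poly (map_poly of_rat ?q) \<beta> = 0"
      using that by (simp add: map_poly_pCons algebra_simps power2_eq_square)
    then have "min_poly \<beta> dvd ?q" by (rule min_poly_dvd[OF alg])
    then have "?q = 0 \<or> degree (min_poly \<beta>) \<le> degree ?q" using dvd_imp_degree_le by blast
    moreover have "degree ?q \<le> 2" by simp
    ultimately have "?q = 0" using assms(3) unfolding algebraic_degree_def by auto
    then show ?thesis by simp
  qed
  have "cubic \<beta> a b c \<alpha>1 \<alpha>2"
    by unfold_locales (fact assms(1) ceq sum prod indep)+
  moreover have "galois_conjugates \<beta> = {of_real \<beta>, \<alpha>1, \<alpha>2}"
  proof -
    have "poly (map_poly of_rat (min_poly \<beta>)) z = (z - of_real \<beta>) * (z - \<alpha>1) * (z - \<alpha>2)" for z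
    proof -
      have c: "(of_int c :: complex) = of_real \<beta> ^ 3 - of_int a * of_real \<beta> ^ 2 - of_int b * of_real \<beta>"
        using arg_cong[OF ceq, of complex_of_real] by (simp add: algebra_simps)
      have "(z - of_real \<beta>) * (z - \<alpha>1) * (z - \<alpha>2) =
          (z - of_real \<beta>) * (z\<^sup>2 - (\<alpha>1 + \<alpha>2) * z + \<alpha>1 * \<alpha>2)"
        by (simp add: algebra_simps power2_eq_square)
      also have "\<dots> = z ^ 3 - of_int a * z\<^sup>2 - of_int b * z - of_int c"
        unfolding sum prod c by (simp add: algebra_simps power2_eq_square power3_eq_cube)
      finally show ?thesis unfolding mpeq by simp
    qed
    then show ?thesis unfolding galois_conjugates_def by auto
  qed
  ultimately show thesis by (rule that)
qed

lemma (in cubic_unit) pisot_unitI: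
  assumes "galois_conjugates \<beta> = {of_real \<beta>, \<alpha>1, \<alpha>2}" "norm \<alpha>1 < 1" "norm \<alpha>2 < 1"
  shows "pisot_unit \<beta>"
proof -
  have e1: "poly [:of_int (- c), of_int (- b), of_int (- a), 1:] \<beta> = 0"
    using cubic_eq by (simp add: algebra_simps power2_eq_square power3_eq_cube)
  have alg: "algebraic_int \<beta>"
    by (rule algebraic_int.intros[OF _ _ e1]) (auto simp: coeff_pCons split: nat.split)
  have c2: "real_of_int c * of_int c = 1" using c_sq by (metis of_int_1 of_int_mult)
  \<comment> \<open>The reversed cubic multiplied by \<open>- c\<close>, which makes it monic
    because \<open>c * c = 1\<close>.\<close>
  have "poly [:of_int (- c), of_int (c * a), of_int (c * b), 1:] (1 / \<beta>) * \<beta> ^ 3 =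
      1 - of_int c * (\<beta> ^ 3 - a * \<beta>\<^sup>2 - b * \<beta>)"
    using gt1 by (simp add: field_simps power2_eq_square power3_eq_cube)
  also have "\<dots> = 0" unfolding cubic_eq using c2 by simp
  finally have e2: "poly [:of_int (- c), of_int (c * a), of_int (c * b), 1:] (1 / \<beta>) = 0"
    using gt1 by simp
  have "algebraic_int (1 / \<beta>)"
    by (rule algebraic_int.intros[OF _ _ e2]) (auto simp: coeff_pCons split: nat.split)
  moreover have "1 / \<beta> \<in> generated_field \<beta>" unfolding generated_field_def by blast
  ultimately have "\<exists>y \<in> ring_of_integers (generated_field \<beta>). \<beta> * y = 1"
    using gt1 by (intro bexI[of _ "1 / \<beta>"]) (auto simp: ring_of_integers_def)
  then show ?thesis
    unfolding pisot_unit_def pisot_number_def assms(1) using alg gt1 assms(2,3) by auto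
qed

section \<open>The theorem\<close>

text \<open>One periodic rational makes all real conjugates negative. This fixes the norm as 1 and,
  for \<open>b \<le> - 2\<close>, forces complex conjugates, which \<open>gamma_not_pos\<close>
  excludes.\<close>

lemma (in cubic_pisot) gamma_pos_imp_property_F:
  assumes "gamma \<beta> > 0"
  shows "property_F \<beta>"
proof -
  obtain c0 where c0: "c0 > 0" "c0 < 1"
    "\<And>x. x \<in> \<rat> \<Longrightarrow> 0 \<le> x \<Longrightarrow> x \<le> c0 \<Longrightarrow> \<exists>p>0. (T ^^ p) x = x"
    using assms unfolding gamma_pos_iff by blast
  obtain r where r: "r \<in> \<rat>" "0 < r" "r < c0" using Rats_dense_in_real[OF c0(1)] by blast
  obtain p where p: "p > 0" "(T ^^ p) r = r" using c0(3)[of r] r by auto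
  have np: "t \<le> 0" if "\<alpha>1 = of_real t \<or> \<alpha>2 = of_real t" for t
    using that conj_not_positive[OF r(1,2) _ p(2,1) conj_lt_1(1)]
      cubic.conj_not_positive[OF swap_conj r(1,2) _ p(2,1) conj_lt_1(2)] r(3) c0(2) by auto
  have neg: "t < 0" if "\<alpha>1 = of_real t \<or> \<alpha>2 = of_real t" for t
    using np[OF that] that conj_nz by (cases "t = 0") auto
  have cp: "complex_of_real \<beta> * (\<alpha>1 * \<alpha>2) = of_int c"
    unfolding prod_conj using arg_cong[OF c_eq, of complex_of_real] by simp
  have "c > 0"
    using conj_cases
  proof
    assume "\<alpha>1 \<in> \<real> \<and> \<alpha>2 \<in> \<real>"
    then obtain s t where st: "\<alpha>1 = of_real s" "\<alpha>2 = of_real t" by (auto elim!: Reals_cases)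
    then have "s < 0" "t < 0" using neg by auto
    have "complex_of_real (\<beta> * (s * t)) = of_real (of_int c)" using cp unfolding st by simp
    then have "\<beta> * (s * t) = of_int c" by (simp only: of_real_eq_iff)
    moreover have "\<beta> * (s * t) > 0" using \<open>s < 0\<close> \<open>t < 0\<close> gt1 by (simp add: mult_neg_neg)
    ultimately show "c > 0" by simp
  next
    assume "\<alpha>2 = cnj \<alpha>1"
    then have "complex_of_real (\<beta> * (norm \<alpha>1)\<^sup>2) = of_real (of_int c)"
      using cp complex_norm_square[of \<alpha>1] by simp
    then have "\<beta> * (norm \<alpha>1)\<^sup>2 = of_int c" by (simp only: of_real_eq_iff)
    moreover have "\<beta> * (norm \<alpha>1)\<^sup>2 > 0" using gt1 conj_nz by simp
    ultimately show "c > 0" by simp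
  qed
  then have "c = 1" using unit by simp
  then interpret cubic_pisot1 by unfold_locales
  show ?thesis
  proof (cases "- 1 \<le> b")
    case True
    then show ?thesis
      unfolding property_F_iff using finite_if_srs_finite srs_finite_akiyama coeff_bounds \<open>c = 1\<close> by force
  next
    case False
    then have b: "b \<le> - 2" by simp
    have "\<alpha>2 \<noteq> cnj \<alpha>1"
    proof
      assume "\<alpha>2 = cnj \<alpha>1"
      then interpret cubic_pisot_complex using b by unfold_locales
      show False using gamma_not_pos assms by simp
    qed
    then obtain s t where st: "\<alpha>1 = of_real s" "\<alpha>2 = of_real t" using conj_cases by (auto elim!: Reals_cases)
    \<comment> \<open>Real conjugates would both be negative, yet their sum \<open>- r1\<close> is
      positive.\<close>
    have "\<beta> * r1 < 0" unfolding beta_r1 using r0_range b by simp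
    then have "r1 < 0" using gt1 by (simp add: mult_less_0_iff)
    moreover have "complex_of_real (s + t) = of_real (a - \<beta>)" using sum_conj unfolding st by simp
    then have "s + t = a - \<beta>" by (simp only: of_real_eq_iff)
    moreover have "s < 0" "t < 0" using neg st by auto
    ultimately show ?thesis by (simp add: r1_def)
  qed
qed

theorem theorem1p1:
  fixes \<beta> :: real
  assumes "\<beta> > 1" and "algebraic \<beta>" and "algebraic_degree \<beta> = 3"
  shows "gamma \<beta> > 0 \<longleftrightarrow> pisot_unit \<beta> \<and> property_F \<beta>"
proof
  interpret beta_map \<beta> by unfold_locales (rule assms(1))
  assume gp: "gamma \<beta> > 0"
  then obtain c0 where c0: "c0 > 0" "c0 < 1"
    "\<And>x. x \<in> \<rat> \<Longrightarrow> 0 \<le> x \<Longrightarrow> x \<le> c0 \<Longrightarrow> \<exists>p>0. (T ^^ p) x = x"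
    unfolding gamma_pos_iff by blast
  \<comment> \<open>One \<open>n\<close> serves twice: \<open>1 / n\<close> shows integrality, and
    \<open>1 / (\<bar>c\<bar> * n)\<close>, available once the cubic is known, shows that
    \<open>\<beta>\<close> is a unit.\<close>
  obtain n where n: "n > 0" "1 / real n < c0"
    using c0(1) by (metis inverse_eq_divide real_arch_inverse gr0I)
  have small: "1 / (real k * n) \<le> c0" if "k > 0" for k
  proof -
    have "1 / (real k * n) \<le> 1 / real n"
      using n(1) that by (intro divide_left_mono) auto
    then show ?thesis using n(2) by simp
  qed
  have per: "\<exists>p>0. (T ^^ p) (1 / (real k * n)) = 1 / (real k * n)" if "k > 0" for k
    using small[OF that] by (intro c0(3)) auto
  obtain p where p: "p > 0" "(T ^^ p) (1 / real n) = 1 / real n" using per[of 1] by auto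
  have "algebraic_int \<beta>" using algebraic_int_if_periodic[OF n(1) p(2,1)] .
  from cubic_exists[OF assms(1) this assms(3)] obtain a b c \<alpha>1 \<alpha>2 where
    cub: "cubic \<beta> a b c \<alpha>1 \<alpha>2" and gal: "galois_conjugates \<beta> = {of_real \<beta>, \<alpha>1, \<alpha>2}" .
  interpret cubic \<beta> a b c \<alpha>1 \<alpha>2 by (rule cub)
  interpret swap: cubic \<beta> a b c \<alpha>2 \<alpha>1 by (rule swap_conj)
  have cnz: "c \<noteq> 0"
  proof
    assume "c = 0"
    then have "\<beta>\<^sup>2 - a * \<beta> - b = 0" using c_eq gt1 by simp
    then have "of_int (- b) + of_int (- a) * \<beta> + of_int 1 * \<beta>\<^sup>2 = 0" by simp
    from indep[OF this] show False by simp
  qed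
  have "\<exists>p>0. (T ^^ p) (1 / (\<bar>c\<bar> * n)) = 1 / (\<bar>c\<bar> * n)"
    using per[of "nat \<bar>c\<bar>"] cnz by simp
  then obtain p' where p': "p' > 0" "(T ^^ p') (1 / (\<bar>c\<bar> * n)) = 1 / (\<bar>c\<bar> * n)" by blast
  have "\<bar>c\<bar> = 1" using unit_if_periodic[OF cnz n(1) p'(2,1)] .
  then interpret cubic_unit \<beta> a b c \<alpha>1 \<alpha>2 by unfold_locales
  have lt: "norm \<alpha>1 < 1" "norm \<alpha>2 < 1"
    using conj_norm_le_1[OF c0] conj_norm_ne_1 swap.conj_norm_le_1[OF c0] swap.conj_norm_ne_1 by auto
  then interpret cubic_pisot \<beta> a b c \<alpha>1 \<alpha>2 by unfold_locales
  show "pisot_unit \<beta> \<and> property_F \<beta>"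
    using pisot_unitI[OF gal lt] gamma_pos_imp_property_F[OF gp] by blast
next
  assume pf: "pisot_unit \<beta> \<and> property_F \<beta>"
  then have alg: "algebraic_int \<beta>" and small: "\<And>z. z \<in> galois_conjugates \<beta> \<Longrightarrow> z \<noteq> of_real \<beta> \<Longrightarrow> norm z < 1"
    unfolding pisot_unit_def pisot_number_def by auto
  from cubic_exists[OF assms(1) alg assms(3)] obtain a b c \<alpha>1 \<alpha>2 where
    cub: "cubic \<beta> a b c \<alpha>1 \<alpha>2" and gal: "galois_conjugates \<beta> = {of_real \<beta>, \<alpha>1, \<alpha>2}" .
  interpret cubic \<beta> a b c \<alpha>1 \<alpha>2 by (rule cub)
  interpret swap: cubic \<beta> a b c \<alpha>2 \<alpha>1 by (rule swap_conj)
  obtain y where "algebraic_int y" "\<beta> * y = 1"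
    using pf unfolding pisot_unit_def ring_of_integers_def by blast
  then have "\<bar>c\<bar> = 1" by (rule unit_if_algebraic_int_inverse)
  then interpret cubic_unit \<beta> a b c \<alpha>1 \<alpha>2 by unfold_locales
  have "norm \<alpha>1 < 1" "norm \<alpha>2 < 1"
    using small gal conj_ne_beta swap.conj_ne_beta by auto
  then interpret cubic_pisot \<beta> a b c \<alpha>1 \<alpha>2 by unfold_locales
  show "gamma \<beta> > 0"
    using pf unfolding property_F_iff by (intro small_rationals_periodic) blast
qed

end
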